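(* Let $a$ be an integer with $|a|>1$ and $\gcd(a,s)=1$. If $|a|>C$, where \[ \log C=mS+(m+1)\Big(3+\log\big(d\,\tilde d\,s_0\,\epsilon(s_0)\,\epsilon(s)^2\,\epsilon(v)\big)+2s_0+(m+1)V\Big), \] then there is no $a$-global relation, i.e. there is no $(\ell_0,\dots,\ell_m)\in\mathbb{Z}^{m+1}\setminus\{0\}$ such that $\ell_0+\ell_1\varphi_1(a)+\cdots+\ell_m\varphi_m(a)=0$ holds in $\mathbb{Q}_p$ for every prime $p\mid a$.
   Context: Let $m\ge1$ and let $\alpha_0,\alpha_1,\dots,\alpha_m$ be positive rational numbers with $\alpha_i-\alpha_j\notin\mathbb{Z}$ for $1\le i<j\le m$. Pochhammer symbol: $(x)_0=1$, $(x)_n=x(x+1)\cdots(x+n-1)$. $\varphi_j(z)=\sum_{n\ge0}\frac{(\alpha_j)_n}{(\alpha_j+\alpha_0)_n}z^n$; for a prime $p\mid a$ with $\gcd(a,s)=1$ the series converges in $\mathbb{Q}_p$ at $z=a$ and $\varphi_j(a)$ denotes its $p$-adic sum. Write $\alpha_j=r_j/s_j$ ($j=0,\dots,m$) and $\alpha_j+\alpha_0=u_j/v_j$ ($j=1,\dots,m$) with positive integers in lowest terms; $S=\max_{1\le j\le m}s_j$, $V=\max_{1\le j\le m}v_j$; $d_j$ is the positive integer with $s_0s_j=d_jv_j$; $s,v,d$ are the least common multiples of $s_j$, $v_j$, $d_j$ ($j=1,\dots,m$); $\tilde d=d/\gcd(d,s_0)$; $\epsilon(n)=\prod_{p\mid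 n}p^{1/(p-1)}$ (product over primes). *)

theory Defs
  imports Complex_Main "HOL-Computational_Algebra.Primes"
begin

definition padic_val_rat :: "nat \<Rightarrow> rat \<Rightarrow> int" where
  "padic_val_rat p q = int (multiplicity (int p) (fst (quotient_of q)))
                      - int (multiplicity (int p) (snd (quotient_of q)))"

definition padic_abs :: "nat \<Rightarrow> rat \<Rightarrow> real" where
  "padic_abs p q = (if q = 0 then 0 else real p powr (- real_of_int (padic_val_rat p q)))"

definition phi_coeff :: "(nat \<Rightarrow> rat) \<Rightarrow> nat \<Rightarrow> nat \<Rightarrow> rat" where
  "phi_coeff \<alpha> j n = pochhammer (\<alpha> j) n / pochhammer (\<alpha> j + \<alpha> 0) n"

definition lin_partial :: "(nat \<Rightarrow> rat) \<Rightarrow> nat \<Rightarrow> (nat \<Rightarrow> int) \<Rightarrow> int \<Rightarrow> nat \<Rightarrow> rat" where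
  "lin_partial \<alpha> m l a N =
     of_int (l 0) + (\<Sum>j=1..m. of_int (l j) * (\<Sum>n<N. phi_coeff \<alpha> j n * of_int a ^ n))"

(* l_0 + sum l_j phi_j(a) = 0 in Q_p : the rational partial sums tend to 0 p-adically *)
definition padic_relation :: "(nat \<Rightarrow> rat) \<Rightarrow> nat \<Rightarrow> (nat \<Rightarrow> int) \<Rightarrow> int \<Rightarrow> nat \<Rightarrow> bool" where
  "padic_relation \<alpha> m l a p \<longleftrightarrow> (\<lambda>N. padic_abs p (lin_partial \<alpha> m l a N)) \<longlonglongrightarrow> 0"

definition global_relation :: "(nat \<Rightarrow> rat) \<Rightarrow> nat \<Rightarrow> int \<Rightarrow> bool" where
  "global_relation \<alpha> m a \<longleftrightarrow>
     (\<exists>l :: nat \<Rightarrow> int. (\<exists>j\<le>m. l j \<noteq> 0) \<and>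
        (\<forall>p. prime p \<longrightarrow> int p dvd a \<longrightarrow> padic_relation \<alpha> m l a p))"

definition sden :: "(nat \<Rightarrow> rat) \<Rightarrow> nat \<Rightarrow> nat" where
  "sden \<alpha> j = nat (snd (quotient_of (\<alpha> j)))"

definition vden :: "(nat \<Rightarrow> rat) \<Rightarrow> nat \<Rightarrow> nat" where
  "vden \<alpha> j = nat (snd (quotient_of (\<alpha> j + \<alpha> 0)))"

(* d_j with s_0 s_j = d_j v_j *)
definition dfac :: "(nat \<Rightarrow> rat) \<Rightarrow> nat \<Rightarrow> nat" where
  "dfac \<alpha> j = sden \<alpha> 0 * sden \<alpha> j div vden \<alpha> j"

definition S_max :: "(nat \<Rightarrow> rat) \<Rightarrow> nat \<Rightarrow> nat" where
  "S_max \<alpha> m = Max (sden \<alpha> ` {1..m})"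

definition V_max :: "(nat \<Rightarrow> rat) \<Rightarrow> nat \<Rightarrow> nat" where
  "V_max \<alpha> m = Max (vden \<alpha> ` {1..m})"

definition s_lcm :: "(nat \<Rightarrow> rat) \<Rightarrow> nat \<Rightarrow> nat" where
  "s_lcm \<alpha> m = Lcm (sden \<alpha> ` {1..m})"

definition v_lcm :: "(nat \<Rightarrow> rat) \<Rightarrow> nat \<Rightarrow> nat" where
  "v_lcm \<alpha> m = Lcm (vden \<alpha> ` {1..m})"

definition d_lcm :: "(nat \<Rightarrow> rat) \<Rightarrow> nat \<Rightarrow> nat" where
  "d_lcm \<alpha> m = Lcm (dfac \<alpha> ` {1..m})"

definition d_tilde :: "(nat \<Rightarrow> rat) \<Rightarrow> nat \<Rightarrow> nat" where
  "d_tilde \<alpha> m = d_lcm \<alpha> m div gcd (d_lcm \<alpha> m) (sden \<alpha> 0)"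

definition eps :: "nat \<Rightarrow> real" where
  "eps n = (\<Prod>p\<in>prime_factors n. real p powr (1 / (real p - 1)))"

definition logC :: "(nat \<Rightarrow> rat) \<Rightarrow> nat \<Rightarrow> real" where
  "logC \<alpha> m =
     real m * real (S_max \<alpha> m)
     + (real m + 1) * (3 + ln (real (d_lcm \<alpha> m) * real (d_tilde \<alpha> m) * real (sden \<alpha> 0)
                              * eps (sden \<alpha> 0) * eps (s_lcm \<alpha> m) ^ 2 * eps (v_lcm \<alpha> m))
                        + 2 * real (sden \<alpha> 0) + (real m + 1) * real (V_max \<alpha> m))"

end

theory Submission
  imports Defs "HOL-Computational_Algebra.Polynomial" "HOL-Number_Theory.Cong"
begin

text \<open>
  Write \<open>c\<^sub>j(i)\<close> for the coefficients of \<open>\<phi>\<^sub>j\<close>, \<open>\<lambda>\<^sub>k\<close> for the \<open>k\<close>-th partial sum of the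
  linear form at \<open>a\<close>, and \<open>N = mn + m\<close>. A polynomial \<open>A\<close> of degree at most \<open>N\<close> has a unique expansion
  \<open>(\<alpha>\<^sub>0)\<^sub>N A(x) = \<Sum>\<^sub>k p\<^sub>k (x)\<^sub>k (x + \<alpha>\<^sub>0 + k)\<^sub>N\<^sub>-\<^sub>k\<close>, whose coefficients are explicit by Chu-Vandermonde. Evaluating
  at \<open>x = \<alpha>\<^sub>j + i\<close> turns it into a formula for \<open>\<Sum>\<^sub>k p\<^sub>k c\<^sub>j(k + i)\<close>, so that taking \<open>A\<close> to be
  \<open>(-x)\<^sup>e \<Prod>\<^sub>j (\<alpha>\<^sub>j - x)\<^sub>n / n!\<close>, which vanishes at \<open>\<alpha>\<^sub>j + i\<close> for \<open>i < n\<close>, yields type II Pade approximants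
  of all the \<open>\<phi>\<^sub>j\<close> at once.

  Put \<open>W = \<Sum>\<^sub>k p\<^sub>k a\<^sup>N\<^sup>-\<^sup>k \<lambda>\<^sub>k\<close>. If the relation holds \<open>p\<close>-adically for all \<open>p\<close> dividing \<open>a\<close>, then \<open>W\<close> is divisible by
  \<open>a\<^sup>N\<^sup>+\<^sup>n\<close> up to a power of \<open>a\<close> with exponent \<open>O(log n)\<close>, whereas \<open>|W|\<close> is at most \<open>|a|\<^sup>N\<close> times a factor
  exponential in \<open>n\<close>, and so is its denominator. Some \<open>e \<le> m\<close> has \<open>W \<noteq> 0\<close>: otherwise a combination of the
  approximants vanishes at \<open>a\<close>; after division by \<open>z - a\<close> it corresponds, by the same expansion, to an \<open>A\<close>
  of degree less than \<open>N\<close> with the \<open>m(n + 1) = N\<close> zeros \<open>\<alpha>\<^sub>j + i\<close>, \<open>i \<le> n\<close>. Comparing the two estimates as \<open>n\<close> tends to infinity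
  bounds \<open>|a|\<close>.
\<close>

subsection \<open>Denominators of Pochhammer quotients\<close>

text \<open>The part of \<open>fact k\<close> composed of the primes dividing \<open>s\<close>. At
  all other primes, \<open>fact k\<close> already divides a product of \<open>k\<close> terms of a
  progression with difference \<open>s\<close>.\<close>

definition fact_part :: "nat \<Rightarrow> nat \<Rightarrow> nat" where
  "fact_part s k = (\<Prod>p\<in>prime_factors s. p ^ multiplicity p (fact k :: nat))"

lemma fact_part_pos: "fact_part s k > 0"
  unfolding fact_part_def by (intro prod_pos) (auto simp: in_prime_factors_iff prime_gt_0_nat)

lemma multiplicity_fact_part:
  assumes "prime p"
  shows "multiplicity p (fact_part s k) = (if p \<in> prime_factors s then multiplicity p (fact k :: nat) else 0)"
  unfolding fact_part_def
  by (rule multiplicity_prod_prime_powers) (use assms in \<open>auto simp: in_prime_factors_iff\<close>)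

lemma fact_part_dvd_fact: "fact_part s k dvd fact k"
proof (rule multiplicity_le_imp_dvd)
  show "fact_part s k \<noteq> 0" using fact_part_pos[of s k] by simp
qed (auto simp: multiplicity_fact_part)

lemma fact_part_mono: "i \<le> k \<Longrightarrow> fact_part s i dvd fact_part s k"
  unfolding fact_part_def
  by (intro prod_dvd_prod le_imp_power_dvd dvd_imp_multiplicity_le fact_dvd) auto

lemma fact_part_mult_dvd: "fact_part s i * fact_part s j dvd fact_part s (i + j)"
proof -
  have "multiplicity p (fact i :: nat) + multiplicity p (fact j :: nat) \<le> multiplicity p (fact (i + j) :: nat)"
    if "p \<in> prime_factors s" for p
  proof -
    have "multiplicity p (fact i * fact j :: nat) = multiplicity p (fact i :: nat) + multiplicity p (fact j :: nat)"
      using that by (intro prime_elem_multiplicity_mult_distrib) auto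
    moreover have "(fact i * fact j :: nat) dvd fact (i + j)"
      by (rule fact_fact_dvd_fact)
    ultimately show ?thesis by (metis dvd_imp_multiplicity_le fact_nonzero)
  qed
  thus ?thesis
    unfolding fact_part_def prod.distrib[symmetric] power_add[symmetric]
    by (intro prod_dvd_prod le_imp_power_dvd) auto
qed

text \<open>For a prime dividing \<open>s\<close>, the whole multiplicity in \<open>fact k\<close>
  sits in \<open>fact_part s k\<close>, so none is left for the cofactor.\<close>

lemma fact_part_cofactor:
  assumes "s > 0"
  obtains q where "fact k = fact_part s k * q" "coprime q s"
proof -
  obtain q where q: "fact k = fact_part s k * q" using fact_part_dvd_fact[of s k] by (auto elim: dvdE)
  have q0: "q \<noteq> 0" using q by (metis fact_nonzero mult_0_right)
  have "coprime q s"
  proof (rule ccontr)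
    assume "\<not> coprime q s"
    then obtain p where p: "prime p" "p dvd q" "p dvd s"
      using q0 assms by (metis coprime_iff_gcd_eq_1 gcd_greatest_iff prime_factor_nat)
    hence ps: "p \<in> prime_factors s" using assms by (auto simp: in_prime_factors_iff)
    have "multiplicity p (fact k :: nat) = multiplicity p (fact_part s k) + multiplicity p q"
      unfolding q using p q0 fact_part_pos[of s k] by (intro prime_elem_multiplicity_mult_distrib) auto
    hence "multiplicity p q = 0" using p ps by (simp add: multiplicity_fact_part)
    thus False using p q0 by (metis prime_multiplicity_gt_zero_iff less_irrefl prime_imp_prime_elem)
  qed
  thus ?thesis using that q by blast
qed

text \<open>The cofactor \<open>q\<close> of \<open>fact_part S k\<close> in \<open>fact k\<close>
  is coprime to \<open>S\<close>, so \<open>s\<close> has an inverse modulo \<open>q\<close>.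
  Multiplying each term by it turns the progression into \<open>k\<close> consecutive integers
  modulo \<open>q\<close>, whose product is divisible by \<open>fact k\<close> and hence by
  \<open>q\<close>.\<close>

lemma fact_dvd_fact_part_mult_progression:
  fixes r :: int
  assumes "S > 0" "s dvd S"
  shows "fact k dvd int (fact_part S k) * (\<Prod>t<k. r + int s * int t)"
proof -
  obtain q where q: "fact k = fact_part S k * q" "coprime q S"
    using fact_part_cofactor[OF assms(1)] by blast
  have "coprime s q" using q(2) assms(2) by (meson coprime_commute coprime_divisors dvd_refl)
  hence "coprime (int s) (int q)" by simp
  then obtain x where x: "[int s * x = 1] (mod int q)"
    using coprime_iff_invertible_int by blast
  have "[x * (r + int s * int t) = x * r + int t] (mod int q)" for t
  proof -
    have "[(int s * x) * int t = 1 * int t] (mod int q)" using x by (rule cong_scalar_right)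
    hence "[x * r + (int s * x) * int t = x * r + 1 * int t] (mod int q)" by (rule cong_add[OF cong_refl])
    thus ?thesis by (simp add: algebra_simps)
  qed
  hence "[(\<Prod>t<k. x * (r + int s * int t)) = (\<Prod>t<k. x * r + int t)] (mod int q)"
    by (intro cong_prod)
  moreover have "int q dvd (\<Prod>t<k. x * r + int t)"
  proof -
    have "int q dvd int (fact k)" using q(1) by (metis dvd_triv_right int_dvd_int_iff)
    also have "int (fact k) dvd pochhammer (x * r) k" by (metis fact_dvd_pochhammer of_nat_fact)
    finally show ?thesis by (simp add: pochhammer_prod atLeast0LessThan)
  qed
  ultimately have "int q dvd (\<Prod>t<k. x * (r + int s * int t))" by (simp add: cong_dvd_iff)
  hence "int q dvd x ^ k * (\<Prod>t<k. r + int s * int t)" by (simp add: prod.distrib)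
  moreover have "coprime (int q) (x ^ k)"
    using x by (metis cong_imp_coprime cong_sym coprime_1_left coprime_commute coprime_mult_left_iff coprime_power_right_iff)
  ultimately have "int q dvd (\<Prod>t<k. r + int s * int t)" by (simp add: coprime_dvd_mult_right_iff)
  hence "int (fact_part S k) * int q dvd int (fact_part S k) * (\<Prod>t<k. r + int s * int t)" by (rule mult_dvd_mono[OF dvd_refl])
  thus ?thesis using q(1) by (metis of_nat_fact of_nat_mult)
qed

lemma pochhammer_progression:
  fixes r :: int
  assumes "s > 0"
  shows "of_nat s ^ k * pochhammer (of_int r / of_nat s :: rat) k = of_int (\<Prod>t<k. r + int s * int t)"
proof -
  have "of_nat s ^ k * pochhammer (of_int r / of_nat s :: rat) k
      = (\<Prod>t<k. of_nat s * (of_int r / of_nat s + of_nat t))"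
    by (simp add: pochhammer_prod atLeast0LessThan prod.distrib)
  also have "\<dots> = (\<Prod>t<k. of_int (r + int s * int t))"
    using assms by (intro prod.cong) (auto simp: field_simps)
  finally show ?thesis by simp
qed

text \<open>A weak form of Legendre's formula. Only multiples of \<open>p\<close> contribute, so
  v_p(k!) = q + v_p(q!) with \<open>q = k div p\<close>; strong induction and (p - 1) q + q = p q
  \<le> k give the bound.\<close>

lemma multiplicity_fact_bound:
  assumes "prime (p::nat)"
  shows "(p - 1) * multiplicity p (fact k :: nat) \<le> k"
proof -
  have p: "p \<ge> 2" using assms prime_ge_2_nat by blast
  have nz: "multiplicity p (x * y) = multiplicity p x + multiplicity p y" if "x > 0" "y > 0" for x y :: nat
    using that assms by (intro prime_elem_multiplicity_mult_distrib) auto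
  have step: "multiplicity p (fact (p * q + t) :: nat) = multiplicity p (fact (p * q) :: nat)" if "t < p" for q t
    using that
  proof (induction t)
    case (Suc t)
    have "\<not> p dvd p * q + Suc t"
      using Suc.prems by (metis dvd_add_right_iff dvd_triv_left nat_dvd_not_less zero_less_Suc)
    hence "multiplicity p (p * q + Suc t) = 0" by (rule not_dvd_imp_multiplicity_0)
    moreover have "(fact (p * q + Suc t) :: nat) = (p * q + Suc t) * fact (p * q + t)" by simp
    ultimately show ?case using Suc nz[of "p * q + Suc t" "fact (p * q + t)"] by simp
  qed auto
  have block: "multiplicity p (fact (p * q) :: nat) = q + multiplicity p (fact q :: nat)" for q
  proof (induction q)
    case (Suc q)
    have e: "p * Suc q = Suc (p * q + (p - 1))" using p by simp
    have "(fact (p * Suc q) :: nat) = p * Suc q * fact (p * q + (p - 1))"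
      unfolding e by (simp only: fact_Suc of_nat_id)
    hence "multiplicity p (fact (p * Suc q) :: nat)
        = multiplicity p p + multiplicity p (Suc q) + multiplicity p (fact (p * q) :: nat)"
      using nz[of "p * Suc q" "fact (p * q + (p - 1))"] nz[of p "Suc q"] step[of "p - 1" q] p by simp
    also have "multiplicity p p = 1" using assms by (intro multiplicity_prime) auto
    finally show ?case using Suc nz[of "Suc q" "fact q"] by simp
  qed auto
  show ?thesis
  proof (induction k rule: less_induct)
    case (less k)
    show ?case
    proof (cases "k = 0")
      case False
      define q where "q = k div p"
      have "q < k" unfolding q_def using False p by simp
      have k: "k = p * q + k mod p" unfolding q_def by simp
      have "multiplicity p (fact k :: nat) = q + multiplicity p (fact q :: nat)"
        using step[of "k mod p" q] block[of q] k p by (metis gr0I less_numeral_extra(3) mod_less_divisor not_numeral_le_zero)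
      hence "(p - 1) * multiplicity p (fact k :: nat) = (p - 1) * q + (p - 1) * multiplicity p (fact q :: nat)"
        by (simp add: algebra_simps)
      also have "\<dots> \<le> (p - 1) * q + q" using less[OF \<open>q < k\<close>] by simp
      also have "\<dots> = p * q" using p by (simp add: diff_mult_distrib)
      also have "\<dots> \<le> k" using k by linarith
      finally show ?thesis .
    qed auto
  qed
qed

text \<open>By the preceding bound the exponent of each prime \<open>p\<close> is at most k/(p - 1),
  which is the exponent of \<open>p\<close> in \<epsilon>(s)^k.\<close>

lemma fact_part_le_eps_power: "real (fact_part s k) \<le> eps s ^ k"
proof -
  have "real (p ^ multiplicity p (fact k :: nat)) \<le> (real p powr (1 / (real p - 1))) ^ k"
    if "p \<in> prime_factors s" for p
  proof -
    have p: "prime p" "p \<ge> 2" using that by (auto simp: in_prime_factors_iff prime_ge_2_nat)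
    have "real ((p - 1) * multiplicity p (fact k :: nat)) \<le> real k"
      using multiplicity_fact_bound[OF p(1)] by (rule of_nat_mono)
    hence "real (multiplicity p (fact k :: nat)) \<le> 1 / (real p - 1) * real k"
      using p(2) by (simp add: field_simps of_nat_diff)
    hence "real p powr real (multiplicity p (fact k :: nat)) \<le> real p powr (1 / (real p - 1) * real k)"
      using p(2) by (intro powr_mono) auto
    thus ?thesis using p(2) by (simp add: powr_realpow[symmetric] powr_powr)
  qed
  thus ?thesis
    unfolding fact_part_def eps_def of_nat_prod prod_power_distrib
    by (intro prod_mono) auto
qed

lemma eps_ge_1: "eps s \<ge> 1"
  unfolding eps_def
  by (intro prod_ge_1 ge_one_powr_ge_zero)
     (auto simp: in_prime_factors_iff dest!: prime_ge_2_nat)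

text \<open>Induction through (k+1)!/(x)_(k+2) = k!/(x)_(k+1) - k!/(x+1)_(k+1); Pascal's rule then
  merges the two sums.\<close>

lemma fact_div_pochhammer_partial_fractions:
  fixes x :: rat
  assumes "x > 0"
  shows "fact k / pochhammer x (Suc k) = (\<Sum>t\<le>k. (-1) ^ t * of_nat (k choose t) / (x + of_nat t))"
  using assms
proof (induction k arbitrary: x)
  case (Suc k)
  have nz: "pochhammer x (Suc k) \<noteq> 0" "x \<noteq> 0" "x + 1 + of_nat k \<noteq> 0" "pochhammer (x+1) k \<noteq> 0"
    using Suc.prems pochhammer_pos[of x "Suc k"] pochhammer_pos[of "x+1" k] by (auto simp: add_nonneg_eq_0_iff)
  have A: "pochhammer x (Suc k) = x * pochhammer (x+1) k" by (rule pochhammer_rec)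
  have B: "pochhammer (x+1) (Suc k) = pochhammer (x+1) k * (x + 1 + of_nat k)" by (simp add: pochhammer_Suc)
  have C: "pochhammer x (Suc (Suc k)) = x * pochhammer (x+1) k * (x + 1 + of_nat k)"
    by (simp only: pochhammer_rec[of x "Suc k"] B mult.assoc)
  have "fact (Suc k) / pochhammer x (Suc (Suc k)) = fact k / pochhammer x (Suc k) - fact k / pochhammer (x + 1) (Suc k)"
    unfolding A B C using nz by (auto simp: divide_simps) (simp add: algebra_simps)
  also have "\<dots> = (\<Sum>t\<le>k. (-1) ^ t * of_nat (k choose t) / (x + of_nat t))
      - (\<Sum>t\<le>k. (-1) ^ t * of_nat (k choose t) / (x + 1 + of_nat t))"
    using Suc.IH[of x] Suc.IH[of "x+1"] Suc.prems by simp
  also have "(\<Sum>t\<le>k. (-1) ^ t * of_nat (k choose t) / (x + of_nat t))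
     = 1 / x + (\<Sum>t\<le>k. (-1) ^ Suc t * of_nat (k choose Suc t) / (x + of_nat (Suc t)))"
  proof -
    have "(\<Sum>t\<le>k. (-1) ^ t * of_nat (k choose t) / (x + of_nat t)) = (\<Sum>t\<le>Suc k. (-1) ^ t * of_nat (k choose t) / (x + of_nat t))"
      by simp
    also have "\<dots> = 1 / x + (\<Sum>t\<le>k. (-1) ^ Suc t * of_nat (k choose Suc t) / (x + of_nat (Suc t)))"
      by (subst sum.atMost_Suc_shift) simp
    finally show ?thesis .
  qed
  also have "1 / x + (\<Sum>t\<le>k. (-1) ^ Suc t * of_nat (k choose Suc t) / (x + of_nat (Suc t)))
      - (\<Sum>t\<le>k. (-1) ^ t * of_nat (k choose t) / (x + 1 + of_nat t))
     = 1 / x + (\<Sum>t\<le>k. (-1) ^ Suc t * of_nat (Suc k choose Suc t) / (x + of_nat (Suc t)))"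
    by (simp add: sum_subtractf[symmetric] sum_negf[symmetric] add_divide_distrib[symmetric] diff_divide_distrib[symmetric] algebra_simps sum.distrib[symmetric] add_divide_distrib)
  also have "\<dots> = (\<Sum>t\<le>Suc k. (-1) ^ t * of_nat (Suc k choose t) / (x + of_nat t))"
    by (simp only: sum.atMost_Suc_shift) simp
  finally show ?case .
qed auto

text \<open>With x = u/v and L the lcm, partial fractions write L (k-1)!/(x)_k as an integer
  combination of the integers L v/(u + v t). So the product divides L k! v^k, and it is coprime to
  \<open>v\<close>.\<close>

lemma progression_dvd_Lcm_mult_fact:
  assumes "u > 0" "v > 0" "coprime u v" "\<And>t. t < k \<Longrightarrow> u + v * t \<le> X"
  shows "(\<Prod>t<k. u + v * t) dvd Lcm {1..X} * fact k"
proof (cases k)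
  case (Suc i)
  define P where "P = (\<Prod>t<k. u + v * t)"
  define L where "L = Lcm {1..X}"
  have P: "P > 0" unfolding P_def using assms(1) by (intro prod_pos) auto
  define x :: rat where "x = of_nat u / of_nat v"
  have x: "x > 0" using assms unfolding x_def by simp
  have poch: "of_nat v ^ k * pochhammer x k = of_nat P"
    using pochhammer_progression[OF assms(2), of k "int u"] unfolding x_def P_def by (simp add: of_nat_prod)
  have L: "of_nat L / (x + of_nat t) \<in> \<int>" if "t \<le> i" for t
  proof -
    have "u + v * t \<in> {1..X}" using assms(1) assms(4)[of t] that Suc by simp
    hence "u + v * t dvd L" unfolding L_def by (rule dvd_Lcm)
    then obtain w where w: "L = (u + v * t) * w" by (rule dvdE)
    have "x + of_nat t = of_nat (u + v * t) / of_nat v" unfolding x_def using assms(2) by (simp add: field_simps)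
    moreover have "(of_nat (u + v * t) :: rat) \<noteq> 0" using assms(1) by (simp only: of_nat_eq_0_iff)
    ultimately have "of_nat L / (x + of_nat t) = of_nat (w * v)"
      unfolding w by (simp only: of_nat_mult) (simp add: field_simps)
    thus ?thesis by (metis Ints_of_nat)
  qed
  have "of_nat L * fact i / pochhammer x k = (\<Sum>t\<le>i. (-1) ^ t * of_nat (i choose t) * (of_nat L / (x + of_nat t)))"
  proof -
    have "of_nat L * fact i / pochhammer x k = of_nat L * (fact i / pochhammer x (Suc i))" using Suc by simp
    thus ?thesis unfolding fact_div_pochhammer_partial_fractions[OF x, of i] sum_distrib_left
      by (simp add: mult_ac)
  qed
  also have "\<dots> \<in> \<int>" by (intro Ints_sum Ints_mult L) auto
  finally have "of_nat k * (of_nat L * fact i / pochhammer x k) \<in> \<int>" by (intro Ints_mult) auto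
  hence "of_nat (L * fact k) / pochhammer x k \<in> \<int>" using Suc by (simp add: algebra_simps)
  moreover have "pochhammer x k = of_nat P / of_nat v ^ k" using poch assms(2) by (simp add: field_simps)
  ultimately have "of_nat (L * fact k * v ^ k) / (of_nat P :: rat) \<in> \<int>" by simp
  then obtain z where "of_nat (L * fact k * v ^ k) / (of_nat P :: rat) = of_int z" by (rule Ints_cases)
  hence "(of_nat (L * fact k * v ^ k) :: rat) = of_int (z * int P)" using P by (simp add: field_simps)
  hence "int (L * fact k * v ^ k) = z * int P" by (metis of_int_eq_iff of_int_of_nat_eq)
  hence "int P dvd int (L * fact k * v ^ k)" by simp
  hence "P dvd L * fact k * v ^ k" by (simp only: int_dvd_int_iff)
  moreover have "coprime P (v ^ k)"
  proof -
    have "coprime (u + v * t) v" for t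
      using assms(3) by (metis coprime_iff_gcd_eq_1 gcd.commute gcd_add_mult mult.commute add.commute)
    thus ?thesis unfolding P_def by (auto intro!: prod_coprime_left)
  qed
  ultimately show ?thesis unfolding P_def L_def by (simp add: coprime_dvd_mult_left_iff)
qed auto

subsection \<open>The least common multiple of an initial segment\<close>

text \<open>The multiplicity of a prime in an lcm is the maximum over the members, so a prime power
  divides the lcm only by dividing a member.\<close>

lemma prime_power_dvd_Lcm_upto_iff:
  fixes n :: nat
  assumes "prime p"
  shows "p ^ e dvd Lcm {1..n} \<longleftrightarrow> p ^ e \<le> n \<or> e = 0"
proof
  assume "p ^ e \<le> n \<or> e = 0"
  thus "p ^ e dvd Lcm {1..n}" using prime_gt_0_nat[OF assms] by (cases "e = 0") (auto intro!: dvd_Lcm)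
next
  assume *: "p ^ e dvd Lcm {1..n}"
  have "\<exists>k\<in>A. p ^ e dvd k" if "finite A" "p ^ e dvd Lcm A" "e \<noteq> 0" for A
    using that
  proof (induction A)
    case (insert x A)
    show ?case
    proof (cases "p ^ e dvd x \<or> p ^ e dvd Lcm A")
      case False
      have nz: "x \<noteq> 0" "Lcm A \<noteq> 0" using False by (metis dvd_0_right)+
      have "multiplicity p (lcm x (Lcm A)) = max (multiplicity p x) (multiplicity p (Lcm A))"
        using nz by (rule multiplicity_lcm) (use assms in auto)
      moreover have "e \<le> multiplicity p (lcm x (Lcm A))"
        using insert.prems nz assms by (intro multiplicity_geI) (auto simp: lcm_eq_0_iff)
      ultimately have "e \<le> multiplicity p x \<or> e \<le> multiplicity p (Lcm A)" by auto
      thus ?thesis using False by (auto dest: multiplicity_dvd')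
    qed (use insert in auto)
  qed (use assms in \<open>auto simp: prime_gt_1_nat\<close>)
  from this[of "{1..n}"] * show "p ^ e \<le> n \<or> e = 0"
    by (auto dest!: dvd_imp_le)
qed

text \<open>By absorption, i C(p^e, i) = p^e C(p^e - 1, i - 1). Were the binomial coefficient prime
  to \<open>p\<close>, then p^e would divide \<open>i\<close>, which is positive and
  smaller.\<close>

lemma prime_dvd_binomial_prime_power:
  assumes "prime p" "0 < i" "i < p ^ e"
  shows "p dvd p ^ e choose i"
proof (rule ccontr)
  assume "\<not> p dvd p ^ e choose i"
  hence "coprime (p ^ e) (p ^ e choose i)"
    using assms(1) by (simp add: prime_imp_coprime)
  moreover have "i * (p ^ e choose i) = p ^ e * (p ^ e - 1 choose (i - 1))"
    using assms binomial_absorption[of "i - 1" "p ^ e"] by simp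
  hence "p ^ e dvd i * (p ^ e choose i)" by simp
  ultimately have "p ^ e dvd i" by (simp add: coprime_dvd_mult_left_iff)
  thus False using assms by (auto dest: dvd_imp_le)
qed

text \<open>Split \<open>n\<close> as p^e + (n - p^e) in Vandermonde's identity. The term
  \<open>k = 0\<close> vanishes because n - p^e < r, and every other term contains some C(p^e, k)
  with 0 < k < p^e.\<close>

lemma prime_dvd_binomial_central:
  assumes "prime p" "r < p ^ e" "p ^ e \<le> n" "n < p ^ e + r"
  shows "p dvd n choose r"
proof -
  have "n choose r = (\<Sum>k\<le>r. (p ^ e choose k) * (n - p ^ e choose (r - k)))"
    using vandermonde[of "p ^ e" "n - p ^ e" r] assms by simp
  moreover have "p dvd (p ^ e choose k) * (n - p ^ e choose (r - k))" if "k \<le> r" for k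
  proof (cases "k = 0")
    case True
    thus ?thesis using assms by (simp add: binomial_eq_0)
  next
    case False
    thus ?thesis using prime_dvd_binomial_prime_power[of p k e] assms that by auto
  qed
  ultimately show ?thesis by (auto intro!: dvd_sum)
qed

text \<open>Prime by prime: since n \<le> 2k, passing from \<open>k\<close> to \<open>n\<close>
  raises the exponent of \<open>p\<close> by at most one, and only if some p^e lies above
  \<open>k\<close> and not above \<open>n\<close>. In that case \<open>p\<close> divides the
  binomial coefficient.\<close>

lemma Lcm_upto_dvd:
  fixes r n :: nat
  assumes "r \<le> k" "k \<le> n" "n \<le> 2 * k" "n \<le> k + r"
  shows "Lcm {1..n} dvd Lcm {1..k} * (n choose r)"
proof (rule multiplicity_le_imp_dvd)
  fix p :: nat assume p: "prime p"
  have nz: "Lcm {1..j} \<noteq> 0" for j :: nat by (auto simp: Lcm_0_iff)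
  have b: "n choose r > 0" using assms by simp
  define e where "e = multiplicity p (Lcm {1..n})"
  have "p ^ e dvd Lcm {1..n}" unfolding e_def by (rule multiplicity_dvd)
  hence e: "p ^ e \<le> n \<or> e = 0" using prime_power_dvd_Lcm_upto_iff[OF p] by blast
  have "p ^ e dvd Lcm {1..k} * (n choose r)"
  proof (cases "p ^ e \<le> k \<or> e = 0")
    case True
    thus ?thesis using prime_power_dvd_Lcm_upto_iff[OF p] by simp
  next
    case False
    then obtain f where f: "e = Suc f" by (cases e) auto
    have "2 * p ^ f \<le> p * p ^ f" using prime_ge_2_nat[OF p] by (intro mult_right_mono) auto
    also have "\<dots> \<le> 2 * k" using e f assms(3) by simp
    finally have "p ^ f \<le> k" by simp
    hence "p ^ f dvd Lcm {1..k}" using prime_power_dvd_Lcm_upto_iff[OF p] by blast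
    moreover have "p dvd n choose r"
      using p e False assms by (intro prime_dvd_binomial_central[of p r e]) auto
    ultimately show ?thesis unfolding f power_Suc2 by (rule mult_dvd_mono)
  qed
  thus "multiplicity p (Lcm {1..n}) \<le> multiplicity p (Lcm {1..k} * (n choose r))"
    unfolding e_def[symmetric] using nz[of k] b p by (intro multiplicity_geI) auto
qed (auto simp: Lcm_0_iff)

text \<open>Induction that halves \<open>n\<close>: each halving costs a central binomial
  coefficient, at most 4^k both for n = 2k and for n = 2k + 1.\<close>

lemma Lcm_upto_le: "Lcm {1..n} \<le> (4::nat) ^ n"
proof (induction n rule: less_induct)
  case (less n)
  have pos: "Lcm {1..j} > 0" for j :: nat by (rule gr0I) (auto simp: Lcm_0_iff)
  consider "n = 0" | "n = 1" | k where "n = 2 * k" "k \<ge> 1" | k where "n = 2 * k + 1" "k \<ge> 1"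
  proof -
    have "n = 2 * (n div 2) \<or> n = 2 * (n div 2) + 1" by presburger
    thus ?thesis using that by (cases "n div 2 = 0") (force, metis One_nat_def Suc_leI neq0_conv)
  qed
  thus ?case
  proof cases
    case (3 k)
    have "Lcm {1..n} \<le> Lcm {1..k} * (n choose k)"
      using 3 pos[of k] Lcm_upto_dvd[of k k n] by (intro dvd_imp_le) auto
    also have "\<dots> \<le> 4 ^ k * 2 ^ n"
      using less[of k] 3 binomial_le_pow2[of n k] by (intro mult_mono) auto
    also have "\<dots> = 4 ^ n" by (simp add: 3 power_mult power_mult_distrib[symmetric])
    finally show ?thesis .
  next
    case (4 k)
    \<comment> \<open>The two middle entries of an odd row are equal, so each is at most half of the
      row sum.\<close>
    have "2 * (n choose k) \<le> 2 ^ n"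
    proof -
      have "(n choose k) + (n choose Suc k) \<le> (\<Sum>i\<in>{k, Suc k}. n choose i)" by simp
      also have "\<dots> \<le> (\<Sum>i\<le>n. n choose i)" using 4 by (intro sum_mono2) auto
      also have "\<dots> = 2 ^ n" by (rule choose_row_sum)
      finally show ?thesis using binomial_symmetric[of k n] 4 by simp
    qed
    hence b: "n choose k \<le> 4 ^ k" using 4 by (simp add: power_mult)
    have "Lcm {1..n} \<le> Lcm {1..Suc k} * (n choose k)"
      using 4 pos[of "Suc k"] Lcm_upto_dvd[of k "Suc k" n] by (intro dvd_imp_le) auto
    also have "\<dots> \<le> 4 ^ Suc k * 4 ^ k"
      using less[of "Suc k"] 4 b by (intro mult_mono) auto
    also have "\<dots> = 4 ^ n" by (simp add: 4 power_mult power_mult_distrib[symmetric])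
    finally show ?thesis .
  qed auto
qed

subsection \<open>Integrality at a prime\<close>

text \<open>Membership in the localisation of the integers at \<open>p\<close>. Asking for some
  multiplier prime to \<open>p\<close>, rather than speaking of the reduced denominator, makes sums
  and products easy.\<close>

definition p_integral :: "nat \<Rightarrow> rat \<Rightarrow> bool" where
  "p_integral p x \<longleftrightarrow> (\<exists>b::int. \<not> int p dvd b \<and> of_int b * x \<in> \<int>)"

lemma p_integral_Ints: "prime p \<Longrightarrow> x \<in> \<int> \<Longrightarrow> p_integral p x"
  unfolding p_integral_def by (rule exI[of _ 1]) (auto simp: prime_gt_1_nat)

lemma p_integral_of_int [simp]: "prime p \<Longrightarrow> p_integral p (of_int x)"
  and p_integral_of_nat [simp]: "prime p \<Longrightarrow> p_integral p (of_nat n)"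
  and p_integral_0 [simp]: "prime p \<Longrightarrow> p_integral p 0"
  and p_integral_1 [simp]: "prime p \<Longrightarrow> p_integral p 1"
  by (auto intro: p_integral_Ints)

lemma p_integral_mult:
  assumes "prime p" "p_integral p x" "p_integral p y"
  shows "p_integral p (x * y)"
proof -
  obtain b c where "\<not> int p dvd b" "of_int b * x \<in> \<int>" "\<not> int p dvd c" "of_int c * y \<in> \<int>"
    using assms unfolding p_integral_def by auto
  moreover from this have "(of_int b * x) * (of_int c * y) \<in> \<int>" by (metis Ints_mult)
  ultimately have "\<not> int p dvd b * c" "of_int (b * c) * (x * y) \<in> \<int>"
    using assms(1) by (simp add: prime_dvd_mult_iff, simp only: of_int_mult mult_ac)
  thus ?thesis unfolding p_integral_def by blast
qed

lemma p_integral_add: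
  assumes "prime p" "p_integral p x" "p_integral p y"
  shows "p_integral p (x + y)"
proof -
  obtain b c where *: "\<not> int p dvd b" "of_int b * x \<in> \<int>" "\<not> int p dvd c" "of_int c * y \<in> \<int>"
    using assms unfolding p_integral_def by auto
  have "of_int c * (of_int b * x) + of_int b * (of_int c * y) \<in> \<int>"
    by (intro Ints_add Ints_mult[OF Ints_of_int] *(2,4))
  moreover have "of_int (b * c) * (x + y) = of_int c * (of_int b * x) + of_int b * (of_int c * y)"
    by (simp add: algebra_simps)
  ultimately have "\<not> int p dvd b * c" "of_int (b * c) * (x + y) \<in> \<int>"
    using assms(1) * by (simp_all only: prime_dvd_mult_iff prime_nat_int_transfer) auto
  thus ?thesis unfolding p_integral_def by blast
qed

lemma p_integral_minus: "prime p \<Longrightarrow> p_integral p x \<Longrightarrow> p_integral p (- x)"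
  using p_integral_mult[OF _ p_integral_of_int[of p "-1"]] by fastforce

lemma p_integral_diff: "prime p \<Longrightarrow> p_integral p x \<Longrightarrow> p_integral p y \<Longrightarrow> p_integral p (x - y)"
  using p_integral_add[of p x "- y"] p_integral_minus[of p y] by simp

lemma p_integral_power: "prime p \<Longrightarrow> p_integral p x \<Longrightarrow> p_integral p (x ^ k)"
  by (induction k) (auto intro: p_integral_mult)

lemma p_integral_sum: "prime p \<Longrightarrow> (\<And>i. i \<in> A \<Longrightarrow> p_integral p (f i)) \<Longrightarrow> p_integral p (\<Sum>i\<in>A. f i)"
  by (induction A rule: infinite_finite_induct) (auto intro: p_integral_add)

lemma p_integral_prod: "prime p \<Longrightarrow> (\<And>i. i \<in> A \<Longrightarrow> p_integral p (f i)) \<Longrightarrow> p_integral p (\<Prod>i\<in>A. f i)"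
  by (induction A rule: infinite_finite_induct) (auto intro: p_integral_mult)

lemma p_integral_divide_unit:
  assumes "prime p" "p_integral p x" "\<not> int p dvd d"
  shows "p_integral p (x / of_int d)"
proof -
  have "of_int d * (1 / of_int d :: rat) \<in> \<int>" by (cases "d = 0") auto
  hence "p_integral p (1 / of_int d)" using assms(3) unfolding p_integral_def by blast
  thus ?thesis using p_integral_mult[OF assms(1,2)] by fastforce
qed

text \<open>A prime factor of the reduced denominator would contradict integrality at that prime.
  This joins the information at the primes dividing \<open>a\<close> with that at all other
  primes.\<close>

lemma Ints_if_p_integral:
  assumes "\<And>p. prime p \<Longrightarrow> p_integral p x"
  shows "x \<in> \<int>"
proof -
  obtain n d where nd: "quotient_of x = (n, d)" by (cases "quotient_of x")
  have d: "d > 0" "coprime n d" "x = of_int n / of_int d"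
    using quotient_of_denom_pos[OF nd] quotient_of_coprime[OF nd] quotient_of_div[OF nd] by auto
  have "d = 1"
  proof (rule ccontr)
    assume "d \<noteq> 1"
    hence "nat d \<noteq> 1" using d(1) by auto
    then obtain p where p: "prime p" "p dvd nat d" using prime_factor_nat by blast
    obtain b where b: "\<not> int p dvd b" "of_int b * x \<in> \<int>"
      using assms[OF p(1)] unfolding p_integral_def by blast
    from b(2) obtain z where "of_int b * x = of_int z" by (rule Ints_cases)
    hence "(of_int (b * n) :: rat) = of_int (z * d)" using d by (simp add: field_simps)
    hence "b * n = z * d" by (simp only: of_int_eq_iff)
    hence "d dvd b * n" by simp
    hence "d dvd b" using d(2) by (simp add: coprime_dvd_mult_left_iff coprime_commute)
    moreover have "int p dvd d" using p(2) d(1) by (metis int_dvd_int_iff int_nat_eq order_less_imp_le)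
    ultimately show False using b(1) by (meson dvd_trans)
  qed
  thus ?thesis using d by simp
qed

subsection \<open>Inverting the Pochhammer basis\<close>

text \<open>Functions take the place of polynomials so that Pochhammer symbols in \<open>x\<close>
  can be treated as they stand; \<open>N\<close> is only an upper bound of the degree.\<close>

definition poly_fun :: "nat \<Rightarrow> (rat \<Rightarrow> rat) \<Rightarrow> bool" where
  "poly_fun N f \<longleftrightarrow> (\<exists>q. degree q \<le> N \<and> f = poly q)"

lemma poly_fun_mono: "poly_fun M f \<Longrightarrow> M \<le> N \<Longrightarrow> poly_fun N f"
  unfolding poly_fun_def using order_trans by blast

lemma poly_fun_const: "poly_fun N (\<lambda>_. c)"
  unfolding poly_fun_def by (rule exI[of _ "[:c:]"]) auto

lemma poly_fun_linear: "poly_fun 1 (\<lambda>x. c + d * x)"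
  unfolding poly_fun_def by (rule exI[of _ "[:c, d:]"]) (auto simp: mult.commute)

lemma poly_fun_mult:
  assumes "poly_fun M f" "poly_fun N g"
  shows "poly_fun (M + N) (\<lambda>x. f x * g x)"
proof -
  obtain p q where "degree p \<le> M" "f = poly p" "degree q \<le> N" "g = poly q"
    using assms unfolding poly_fun_def by auto
  thus ?thesis unfolding poly_fun_def
    by (intro exI[of _ "p * q"]) (auto intro!: order_trans[OF degree_mult_le])
qed

lemma poly_fun_add:
  assumes "poly_fun N f" "poly_fun N g"
  shows "poly_fun N (\<lambda>x. f x + g x)"
proof -
  obtain p q where "degree p \<le> N" "f = poly p" "degree q \<le> N" "g = poly q"
    using assms unfolding poly_fun_def by auto
  thus ?thesis unfolding poly_fun_def
    by (intro exI[of _ "p + q"]) (auto intro!: degree_add_le)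
qed

lemma poly_fun_sum: "(\<And>i. i \<in> A \<Longrightarrow> poly_fun N (f i)) \<Longrightarrow> poly_fun N (\<lambda>x. \<Sum>i\<in>A. f i x)"
  by (induction A rule: infinite_finite_induct) (auto intro: poly_fun_const poly_fun_add)

lemma poly_fun_prod:
  "finite A \<Longrightarrow> (\<And>i. i \<in> A \<Longrightarrow> poly_fun N (f i)) \<Longrightarrow> poly_fun (card A * N) (\<lambda>x. \<Prod>i\<in>A. f i x)"
proof (induction A rule: finite_induct)
  case (insert i A)
  thus ?case using poly_fun_mult[of N "f i" "card A * N" "\<lambda>x. \<Prod>i\<in>A. f i x"] by simp
qed (auto intro: poly_fun_const)

lemma poly_fun_power: "poly_fun e (\<lambda>x. (c + d * x) ^ e)"
proof (induction e)
  case (Suc e)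
  thus ?case using poly_fun_mult[OF poly_fun_linear] by simp
qed (auto intro: poly_fun_const)

lemma poly_fun_pochhammer: "poly_fun k (\<lambda>x. pochhammer (c + d * x) k)"
proof (induction k)
  case (Suc k)
  have "poly_fun (k + 1) (\<lambda>x. pochhammer (c + d * x) k * (c + of_nat k + d * x))"
    using Suc poly_fun_linear by (rule poly_fun_mult)
  thus ?case by (simp add: pochhammer_Suc algebra_simps)
qed (auto intro: poly_fun_const)

lemma poly_fun_eq_0:
  assumes "poly_fun N f" "finite Z" "card Z > N" "\<And>x. x \<in> Z \<Longrightarrow> f x = 0"
  shows "f x = 0"
proof -
  obtain q where q: "degree q \<le> N" "f = poly q" using assms unfolding poly_fun_def by auto
  have "q = 0"
  proof (rule ccontr)
    assume "q \<noteq> 0"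
    hence fin: "finite {x. poly q x = 0}" and le: "card {x. poly q x = 0} \<le> degree q"
      by (auto intro: poly_roots_finite card_poly_roots_bound)
    have "Z \<subseteq> {x. poly q x = 0}" using assms q by auto
    hence "card Z \<le> degree q" using card_mono[OF fin, of Z] le by linarith
    thus False using assms q by simp
  qed
  thus ?thesis using q by simp
qed

lemma poly_fun_pochhammer_basis:
  assumes "k \<le> N"
  shows "poly_fun N (\<lambda>x. b * pochhammer x k * pochhammer (x + c + of_nat k) (N - k))"
proof -
  have "poly_fun k (\<lambda>x. pochhammer x k)" using poly_fun_pochhammer[of k 0 1] by simp
  moreover have "poly_fun (N - k) (\<lambda>x. pochhammer (x + c + of_nat k) (N - k))"
    using poly_fun_pochhammer[of "N - k" "c + of_nat k" 1] by (simp add: add_ac)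
  ultimately have "poly_fun (0 + k + (N - k)) (\<lambda>x. b * pochhammer x k * pochhammer (x + c + of_nat k) (N - k))"
    by (intro poly_fun_mult poly_fun_const)
  thus ?thesis using assms by simp
qed

text \<open>The system is triangular. At x = -k the terms of index above \<open>k\<close> vanish,
  those of smaller index vanish by induction, and the remaining factor (-k)_k (c)_(M-k) is nonzero
  as c > 0.\<close>

lemma pochhammer_basis_independent:
  fixes c :: rat
  assumes "c > 0" "\<And>x. (\<Sum>k\<le>M. b k * pochhammer x k * pochhammer (x + c + of_nat k) (M - k)) = 0" "k \<le> M"
  shows "b k = 0"
  using assms(3)
proof (induction k rule: less_induct)
  case (less k)
  have "b i * pochhammer (- of_nat k) i * pochhammer (- of_nat k + c + of_nat i) (M - i)
      = (if i = k then b k * (pochhammer (- of_nat k) k * pochhammer c (M - k)) else 0)" if "i \<le> M" for i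
    using less that pochhammer_of_nat_eq_0_lemma[of k i, where ?'a = rat] by (cases "i < k"; cases "i = k") auto
  hence "(\<Sum>i\<le>M. b i * pochhammer (- of_nat k) i * pochhammer (- of_nat k + c + of_nat i) (M - i))
      = (\<Sum>i\<le>M. if i = k then b k * (pochhammer (- of_nat k) k * pochhammer c (M - k)) else 0)"
    by (intro sum.cong) auto
  hence "b k * (pochhammer (- of_nat k) k * pochhammer c (M - k)) = 0"
    using assms(2)[of "- of_nat k"] less.prems by simp
  moreover have "pochhammer (- of_nat k :: rat) k \<noteq> 0" by (simp add: pochhammer_same)
  moreover have "pochhammer c (M - k) \<noteq> 0" using pochhammer_pos[OF assms(1), of "M - k"] by simp
  ultimately show ?case by simp
qed

text \<open>
  Generating function: \<open>\<Sum>\<^sub>k inv_coeff c N A k t\<^sup>k = (1 - t)\<^sup>1\<^sup>-\<^sup>c \<Sum>\<^sub>i (1 - c - N)\<^sub>i / i! A(i) t\<^sup>i\<close>, a Rodrigues formula.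
\<close>

definition inv_coeff :: "rat \<Rightarrow> nat \<Rightarrow> (nat \<Rightarrow> rat) \<Rightarrow> nat \<Rightarrow> rat" where
  "inv_coeff c N A k = (\<Sum>i\<le>k. pochhammer (c - 1) (k - i) / fact (k - i)
       * (pochhammer (1 - c - of_nat N) i / fact i) * A i)"

text \<open>Up to the common sign (-1)^n the terms are C(n, k) (b)_k (-b)_(n-k), and Chu-Vandermonde
  sums them to (b - b)_n = (0)_n.\<close>

lemma sum_pochhammer_alternating_eq_0:
  fixes b :: rat
  assumes "n > 0"
  shows "(\<Sum>k\<le>n. pochhammer b k / fact k * pochhammer (- of_nat n) k * pochhammer (b + 1 - of_nat n + of_nat k) (n - k)) = 0"
proof -
  have "pochhammer b k / fact k * pochhammer (- of_nat n) k * pochhammer (b + 1 - of_nat n + of_nat k) (n - k)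
      = (-1) ^ n * (of_nat (n choose k) * pochhammer b k * pochhammer (- b) (n - k))" if "k \<le> n" for k
  proof -
    have "pochhammer (- of_nat n :: rat) k = (-1) ^ k * (fact k * of_nat (n choose k))"
    proof -
      have "of_nat (n choose k) = (-1) ^ k * pochhammer (- of_nat n :: rat) k / fact k"
        by (simp add: binomial_gbinomial gbinomial_pochhammer)
      thus ?thesis by (simp add: field_simps)
    qed
    moreover have "pochhammer (b + 1 - of_nat n + of_nat k) (n - k) = (-1) ^ (n - k) * pochhammer (- b) (n - k)"
      using pochhammer_minus[of b "n - k"] that
      by (simp add: of_nat_diff algebra_simps)
    moreover have "(-1 :: rat) ^ k * (-1) ^ (n - k) = (-1) ^ n" using that by (simp add: power_add[symmetric])
    ultimately show ?thesis by simp
  qed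
  hence "(\<Sum>k\<le>n. pochhammer b k / fact k * pochhammer (- of_nat n) k * pochhammer (b + 1 - of_nat n + of_nat k) (n - k))
     = (-1) ^ n * (\<Sum>k\<le>n. of_nat (n choose k) * pochhammer b k * pochhammer (- b) (n - k))"
    by (simp add: sum_distrib_left)
  also have "\<dots> = 0" using pochhammer_binomial_sum[of b "- b" n] assms by (simp add: pochhammer_0_left)
  finally show ?thesis .
qed

text \<open>After the two summations are exchanged, A(i) is multiplied by the vanishing alternating
  sum of length l - i whenever i < l. Only A(l) survives, and its factor simplifies to
  (c)_N.\<close>

lemma inv_coeff_at_negative_integer:
  assumes "l \<le> N"
  shows "(\<Sum>k\<le>l. inv_coeff c N A k * pochhammer (- of_nat l) k * pochhammer (c - of_nat l + of_nat k) (N - k))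
     = pochhammer c N * A l"
proof -
  \<comment> \<open>In \<open>g\<close> the second argument is the offset from \<open>i\<close>, so
    that for fixed \<open>i\<close> the inner sum starts at 0.\<close>
  define g where "g = (\<lambda>i k. pochhammer (c - 1) k / fact k * pochhammer (- of_nat l) (i + k)
      * pochhammer (c - of_nat l + of_nat (i + k)) (N - (i + k)))"
  define h where "h = (\<lambda>i. pochhammer (1 - c - of_nat N) i / fact i * A i)"
  have "(\<Sum>k\<le>l. inv_coeff c N A k * pochhammer (- of_nat l) k * pochhammer (c - of_nat l + of_nat k) (N - k))
     = (\<Sum>k\<le>l. \<Sum>i\<le>k. h i * g i (k - i))"
    unfolding inv_coeff_def sum_distrib_right g_def h_def by (intro sum.cong refl) (simp add: mult_ac)
  also have "\<dots> = (\<Sum>i\<le>l. \<Sum>k\<in>{i..l}. h i * g i (k - i))"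
  proof -
    have "(\<Sum>k\<le>l. \<Sum>i\<le>k. h i * g i (k - i)) = (\<Sum>(k,i)\<in>(SIGMA k:{..l}. {..k}). h i * g i (k - i))"
      by (simp add: sum.Sigma)
    also have "\<dots> = (\<Sum>(i,k)\<in>(SIGMA i:{..l}. {i..l}). h i * g i (k - i))"
      by (rule sum.reindex_bij_witness[of _ prod.swap prod.swap]) auto
    finally show ?thesis by (simp add: sum.Sigma)
  qed
  also have "\<dots> = (\<Sum>i\<le>l. h i * (\<Sum>k\<le>l - i. g i k))"
  proof (intro sum.cong refl)
    fix i assume "i \<in> {..l}"
    hence "(\<Sum>k\<in>{i..l}. h i * g i (k - i)) = (\<Sum>k\<le>l - i. h i * g i k)"
      by (intro sum.reindex_bij_witness[of _ "\<lambda>k. i + k" "\<lambda>k. k - i"]) auto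
    thus "(\<Sum>k\<in>{i..l}. h i * g i (k - i)) = h i * (\<Sum>k\<le>l - i. g i k)" by (simp add: sum_distrib_left)
  qed
  also have "\<dots> = (\<Sum>i\<le>l. if i = l then pochhammer c N * A l else 0)"
  proof (intro sum.cong refl)
    fix i assume "i \<in> {..l}"
    hence i: "i \<le> l" by simp
    show "h i * (\<Sum>k\<le>l - i. g i k) = (if i = l then pochhammer c N * A l else 0)"
    proof (cases "i = l")
      case True
      have "pochhammer c N = pochhammer c (N - l) * pochhammer (c + of_nat (N - l)) l"
        using pochhammer_product'[of c "N - l" l] assms by simp
      moreover have "pochhammer (1 - c - of_nat N) l = (-1) ^ l * pochhammer (c + of_nat (N - l)) l"
        using pochhammer_minus[of "c + of_nat N - 1" l] assms by (simp add: of_nat_diff algebra_simps)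
      ultimately show ?thesis using True unfolding h_def g_def
        by (simp add: pochhammer_same power_mult_distrib[symmetric])
    next
      case False
      define n where "n = l - i"
      have n: "n > 0" "l = i + n" using i False unfolding n_def by auto
      have "g i k = pochhammer (- of_nat l) i * pochhammer c (N - l) * (pochhammer (c - 1) k / fact k
          * pochhammer (- of_nat n) k * pochhammer (c - 1 + 1 - of_nat n + of_nat k) (n - k))" if "k \<le> n" for k
      proof -
        have "pochhammer (- of_nat l :: rat) (i + k) = pochhammer (- of_nat l) i * pochhammer (- of_nat n) k"
          using pochhammer_product'[of "- of_nat l :: rat" i k] n by simp
        moreover have "pochhammer (c - of_nat l + of_nat (i + k)) (N - (i + k))
            = pochhammer (c - of_nat n + of_nat k) (n - k) * pochhammer c (N - l)"
        proof -
          have "N - (i + k) = (n - k) + (N - l)" "c - of_nat l + of_nat (i + k) = c - of_nat n + of_nat k"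
            "c - of_nat n + of_nat k + of_nat (n - k) = c"
            using n assms that by (auto simp: of_nat_diff)
          thus ?thesis by (metis pochhammer_product')
        qed
        ultimately show ?thesis unfolding g_def by simp
      qed
      hence "(\<Sum>k\<le>n. g i k) = pochhammer (- of_nat l) i * pochhammer c (N - l) * (\<Sum>k\<le>n. pochhammer (c - 1) k / fact k
          * pochhammer (- of_nat n) k * pochhammer (c - 1 + 1 - of_nat n + of_nat k) (n - k))"
        unfolding sum_distrib_left by (intro sum.cong) auto
      thus ?thesis using sum_pochhammer_alternating_eq_0[OF n(1), of "c - 1"] False n_def by simp
    qed
  qed
  finally show ?thesis by simp
qed

text \<open>Both sides have degree at most \<open>N\<close> in \<open>x\<close> and agree at the N +
  1 points 0, -1, ..., -N: at -l the terms with k > l vanish, and the preceding lemma evaluates the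
  rest.\<close>

lemma inv_coeff_expansion:
  assumes "poly_fun N F"
  shows "(\<Sum>k\<le>N. inv_coeff c N (\<lambda>i. F (- of_nat i)) k * pochhammer x k * pochhammer (x + c + of_nat k) (N - k))
     = pochhammer c N * F x"
proof -
  define f where "f = (\<lambda>x. (\<Sum>k\<le>N. inv_coeff c N (\<lambda>i. F (- of_nat i)) k * pochhammer x k * pochhammer (x + c + of_nat k) (N - k))
      + (- pochhammer c N) * F x)"
  have "f x = 0"
  proof (rule poly_fun_eq_0[where f = f and N = N and Z = "(\<lambda>i. - of_nat i :: rat) ` {..N}"])
    have "poly_fun (0 + N) (\<lambda>x. (- pochhammer c N) * F x)" by (rule poly_fun_mult[OF poly_fun_const assms])
    thus "poly_fun N f" unfolding f_def
      by (intro poly_fun_add poly_fun_sum poly_fun_pochhammer_basis) auto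
    show "card ((\<lambda>i. - of_nat i :: rat) ` {..N}) > N" by (subst card_image) (auto simp: inj_on_def)
  next
    fix x :: rat assume "x \<in> (\<lambda>i. - of_nat i) ` {..N}"
    then obtain l where l: "l \<le> N" "x = - of_nat l" by auto
    have "(\<Sum>k\<le>N. inv_coeff c N (\<lambda>i. F (- of_nat i)) k * pochhammer x k * pochhammer (x + c + of_nat k) (N - k))
      = (\<Sum>k\<le>l. inv_coeff c N (\<lambda>i. F (- of_nat i)) k * pochhammer x k * pochhammer (x + c + of_nat k) (N - k))"
      using l by (intro sum.mono_neutral_right) (auto simp: pochhammer_of_nat_eq_0_lemma)
    also have "\<dots> = pochhammer c N * F x"
      using inv_coeff_at_negative_integer[OF l(1), of c "\<lambda>i. F (- of_nat i)"] l(2) by simp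
    finally show "f x = 0" unfolding f_def by simp
  qed auto
  thus ?thesis unfolding f_def by simp
qed

section \<open>Coefficients of the series in terms of the Pochhammer basis\<close>

lemma phi_coeff_add:
  "phi_coeff \<alpha> j (k + i) = phi_coeff \<alpha> j i * (pochhammer (\<alpha> j + of_nat i) k / pochhammer (\<alpha> j + of_nat i + \<alpha> 0) k)"
proof -
  have "\<alpha> j + \<alpha> 0 + of_nat i = \<alpha> j + of_nat i + \<alpha> 0" by simp
  thus ?thesis
    unfolding phi_coeff_def add.commute[of k i] pochhammer_product' by (simp only: times_divide_times_eq)
qed

text \<open>Over the common denominator (y)_M, where y = \<alpha>_j + i + \<alpha>_0, the sum
  becomes an expansion in the Pochhammer basis evaluated at \<alpha>_j + i. Zeros of the expansion
  thus become relations between the coefficients of \<phi>_j, and conversely.\<close>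

lemma sum_phi_coeff:
  assumes "\<alpha> 0 > 0" "\<alpha> j > 0"
  shows "(\<Sum>k\<le>M. b k * phi_coeff \<alpha> j (k + i)) = phi_coeff \<alpha> j i / pochhammer (\<alpha> j + of_nat i + \<alpha> 0) M
     * (\<Sum>k\<le>M. b k * pochhammer (\<alpha> j + of_nat i) k * pochhammer (\<alpha> j + of_nat i + \<alpha> 0 + of_nat k) (M - k))"
  unfolding sum_distrib_left
proof (intro sum.cong refl)
  fix k assume "k \<in> {..M}"
  define y where "y = \<alpha> j + of_nat i + \<alpha> 0"
  have y: "y > 0" using assms unfolding y_def by (simp add: add_pos_nonneg)
  have p: "pochhammer y k \<noteq> 0" "pochhammer (y + of_nat k) (M - k) \<noteq> 0"
    using pochhammer_pos[OF y, of k] pochhammer_pos[of "y + of_nat k" "M - k"] y by (auto simp: add_pos_nonneg)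
  have "pochhammer y M = pochhammer y k * pochhammer (y + of_nat k) (M - k)"
    using \<open>k \<in> {..M}\<close> pochhammer_product'[of y k "M - k"] by simp
  thus "b k * phi_coeff \<alpha> j (k + i) = phi_coeff \<alpha> j i / pochhammer (\<alpha> j + of_nat i + \<alpha> 0) M
     * (b k * pochhammer (\<alpha> j + of_nat i) k * pochhammer (\<alpha> j + of_nat i + \<alpha> 0 + of_nat k) (M - k))"
    unfolding phi_coeff_add y_def[symmetric] using p by simp
qed

subsection \<open>The approximants and their linear independence\<close>

text \<open>Gaussian elimination for \<open>m\<close> equations in m + 1 unknowns, by induction on
  \<open>m\<close>.\<close>

lemma homogeneous_system_nontrivial_solution:
  fixes M :: "nat \<Rightarrow> nat \<Rightarrow> 'a::field"
  shows "\<exists>y. (\<exists>e\<le>m. y e \<noteq> 0) \<and> (\<forall>i<m. (\<Sum>e\<le>m. M i e * y e) = 0)"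
proof (induction m arbitrary: M)
  case 0
  show ?case by (rule exI[of _ "\<lambda>_. 1"]) auto
next
  case (Suc m)
  show ?case
  proof (cases "\<forall>e\<le>Suc m. M m e = 0")
    case True
    obtain y where y: "\<exists>e\<le>m. y e \<noteq> 0" "\<forall>i<m. (\<Sum>e\<le>m. M i e * y e) = 0"
      using Suc[of M] by blast
    define y' where "y' = y(Suc m := 0)"
    have "(\<Sum>e\<le>Suc m. M i e * y' e) = (\<Sum>e\<le>m. M i e * y e)" for i
      unfolding y'_def by (auto intro!: sum.cong)
    moreover have "\<exists>e\<le>Suc m. y' e \<noteq> 0"
      using y(1) unfolding y'_def by (metis fun_upd_apply le_SucI not_less_eq_eq order_refl)
    ultimately show ?thesis using y(2) True by (intro exI[of _ y']) (auto simp: less_Suc_eq)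
  next
    case False
    then obtain q where q: "q \<le> Suc m" "M m q \<noteq> 0" by blast
    \<comment> \<open>This transposition moves the pivot column \<open>q\<close> to the last place.
      \<open>M'\<close> is the system after elimination, and the last entry of \<open>z\<close>
      solves the pivot equation.\<close>
    define \<sigma> where "\<sigma> = (\<lambda>e. if e = q then Suc m else if e = Suc m then q else e)"
    have bij: "bij_betw \<sigma> {..Suc m} {..Suc m}"
      by (rule bij_betw_byWitness[of _ \<sigma>]) (use q in \<open>auto simp: \<sigma>_def\<close>)
    define M' where "M' = (\<lambda>i e. M i (\<sigma> e) - M i q * M m (\<sigma> e) / M m q)"
    obtain y where y: "\<exists>e\<le>m. y e \<noteq> 0" "\<forall>i<m. (\<Sum>e\<le>m. M' i e * y e) = 0"
      using Suc[of M'] by blast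
    define z where "z = y(Suc m := - (\<Sum>e\<le>m. M m (\<sigma> e) * y e) / M m q)"
    have "\<sigma> (Suc m) = q" unfolding \<sigma>_def by auto
    have *: "(\<Sum>e\<le>Suc m. M i e * z (\<sigma> e)) = (\<Sum>e\<le>m. M i (\<sigma> e) * y e) - M i q * (\<Sum>e\<le>m. M m (\<sigma> e) * y e) / M m q" for i
    proof -
      have "(\<Sum>e\<le>Suc m. M i e * z (\<sigma> e)) = (\<Sum>e\<le>Suc m. M i (\<sigma> e) * z (\<sigma> (\<sigma> e)))"
        using sum.reindex_bij_betw[OF bij, of "\<lambda>e. M i e * z (\<sigma> e)"] by simp
      also have "\<dots> = (\<Sum>e\<le>Suc m. M i (\<sigma> e) * z e)"
        by (intro sum.cong) (auto simp: \<sigma>_def)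
      also have "\<dots> = (\<Sum>e\<le>m. M i (\<sigma> e) * y e) + M i q * z (Suc m)"
        using \<open>\<sigma> (Suc m) = q\<close> by (auto simp: z_def intro!: sum.cong)
      finally show ?thesis by (simp add: z_def)
    qed
    have "(\<Sum>e\<le>Suc m. M i e * z (\<sigma> e)) = 0" if "i < Suc m" for i
    proof (cases "i = m")
      case True
      thus ?thesis using *[of m] q by simp
    next
      case False
      hence "(\<Sum>e\<le>m. M' i e * y e) = 0" using that y by auto
      moreover have "(\<Sum>e\<le>m. M' i e * y e) = (\<Sum>e\<le>m. M i (\<sigma> e) * y e) - M i q * (\<Sum>e\<le>m. M m (\<sigma> e) * y e) / M m q"
        unfolding M'_def
        by (simp add: algebra_simps sum_subtractf sum_distrib_left sum_divide_distrib)
      ultimately show ?thesis using *[of i] by simp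
    qed
    moreover have "\<exists>e\<le>Suc m. z (\<sigma> e) \<noteq> 0"
    proof -
      obtain e where e: "e \<le> m" "y e \<noteq> 0" using y by blast
      hence "z (\<sigma> (\<sigma> e)) \<noteq> 0" "\<sigma> e \<le> Suc m" using q by (auto simp: \<sigma>_def z_def)
      thus ?thesis by blast
    qed
    ultimately show ?thesis by (intro exI[of _ "z \<circ> \<sigma>"]) auto
  qed
qed

text \<open>The recurrence b(N+1) = z b(N) + p(N+1) carries the induction. With \<open>c\<close> the
  coefficients of \<phi>_j, the left side is the numerator P_j of the approximant at
  \<open>z\<close>; if Q(z) = b(N) = 0, only the last sum remains.\<close>

lemma weighted_partial_sums_by_horner:
  fixes p c :: "nat \<Rightarrow> rat" and z :: rat
  defines "b \<equiv> \<lambda>k. \<Sum>t\<le>k. p t * z ^ (k - t)"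
  shows "(\<Sum>k\<le>N. p k * z ^ (N - k) * (\<Sum>i<k. c i * z ^ i)) = b N * (\<Sum>i<N. c i * z ^ i) - z ^ N * (\<Sum>i<N. b i * c i)"
proof (induction N)
  case (Suc N)
  have b: "b (Suc N) = z * b N + p (Suc N)"
    unfolding b_def by (simp add: Suc_diff_le sum_distrib_left mult_ac cong: sum.cong_simp)
  have "(\<Sum>k\<le>Suc N. p k * z ^ (Suc N - k) * (\<Sum>i<k. c i * z ^ i))
      = z * (\<Sum>k\<le>N. p k * z ^ (N - k) * (\<Sum>i<k. c i * z ^ i)) + p (Suc N) * (\<Sum>i<Suc N. c i * z ^ i)"
    unfolding sum.atMost_Suc sum_distrib_left
    by (intro arg_cong2[of _ _ _ _ "(+)"] sum.cong) (auto simp: Suc_diff_le)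
  also have "\<dots> = b (Suc N) * (\<Sum>i<Suc N. c i * z ^ i) - z ^ Suc N * (\<Sum>i<Suc N. b i * c i)"
    unfolding Suc b by (simp add: algebra_simps)
  finally show ?case .
qed (simp add: b_def)

lemma phi_coeff_pos: "\<alpha> 0 > 0 \<Longrightarrow> \<alpha> j > 0 \<Longrightarrow> phi_coeff \<alpha> j i > 0"
  unfolding phi_coeff_def by (simp add: pochhammer_pos)

text \<open>
  The numbers \<open>b k\<close> of the proof are the coefficients of \<open>Q(x) / (x - z)\<close> in Horner's scheme.
\<close>

lemma approximants_have_no_common_zero:
  fixes z :: rat and \<alpha> :: "nat \<Rightarrow> rat"
  assumes m: "m \<ge> 1"
    and pos: "\<And>j. j \<le> m \<Longrightarrow> \<alpha> j > 0"
    and dist: "\<And>i j. 1 \<le> i \<Longrightarrow> i < j \<Longrightarrow> j \<le> m \<Longrightarrow> \<alpha> i - \<alpha> j \<notin> \<int>"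
    and z: "z \<noteq> 0"
    and N: "N = m * n + m"
    and A: "poly_fun N A" "\<And>j i. 1 \<le> j \<Longrightarrow> j \<le> m \<Longrightarrow> i < n \<Longrightarrow> A (\<alpha> j + of_nat i) = 0"
    and p: "p = inv_coeff (\<alpha> 0) N (\<lambda>i. A (- of_nat i))"
    and Q: "(\<Sum>k\<le>N. p k * z ^ (N - k)) = 0"
    and P: "\<And>j. 1 \<le> j \<Longrightarrow> j \<le> m \<Longrightarrow> (\<Sum>k\<le>N. p k * z ^ (N - k) * (\<Sum>i<k. phi_coeff \<alpha> j i * z ^ i)) = 0"
  shows "A x = 0"
proof -
  define b where "b = (\<lambda>k. \<Sum>t\<le>k. p t * z ^ (k - t))"
  obtain M where M: "N = Suc M" using m N not0_implies_Suc[of N] by auto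
  have bN: "b (Suc M) = 0" using Q unfolding b_def M by simp
  have p0: "p 0 = b 0" unfolding b_def by simp
  have pS: "p (Suc k) = b (Suc k) - z * b k" for k
    unfolding b_def by (simp add: Suc_diff_le sum_distrib_left mult_ac cong: sum.cong_simp)
  have a0: "\<alpha> 0 > 0" using pos by simp
  have expand: "(\<Sum>k\<le>N. p k * pochhammer x k * pochhammer (x + \<alpha> 0 + of_nat k) (N - k)) = pochhammer (\<alpha> 0) N * A x" for x
    unfolding p by (rule inv_coeff_expansion[OF A(1)])
  define H where "H = (\<lambda>j i. \<Sum>k\<le>M. b k * phi_coeff \<alpha> j (k + i))"
  \<comment> \<open>Since p(k+1) = b(k+1) - z b(k), the relation saying that the sum of p(k)
    c_j(k+i) is 0 for i < n reads H_j(i) = z H_j(i+1). Starting from H_j(0) = 0, which encodes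
    P_j(z) = 0, this reaches i = n, one index further than the zeros of \<open>A\<close>.\<close>
  have H: "H j i = 0" if j: "1 \<le> j" "j \<le> m" and i: "i \<le> n" for i j
    using i
  proof (induction i)
    case 0
    have "0 = - (z ^ N * (\<Sum>i<N. b i * phi_coeff \<alpha> j i))"
      using P[OF j] weighted_partial_sums_by_horner[of p z N "phi_coeff \<alpha> j"] bN unfolding b_def M by simp
    thus ?case using z unfolding H_def M lessThan_Suc_atMost by simp
  next
    case (Suc i)
    have "(\<Sum>k\<le>N. p k * phi_coeff \<alpha> j (k + i)) = 0"
      unfolding sum_phi_coeff[OF a0 pos[OF j(2)]] expand using A(2)[OF j, of i] Suc by simp
    moreover have "(\<Sum>k\<le>N. p k * phi_coeff \<alpha> j (k + i))
        = (\<Sum>k\<le>N. b k * phi_coeff \<alpha> j (k + i)) - (\<Sum>k\<le>M. z * b k * phi_coeff \<alpha> j (Suc k + i))"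
      unfolding M sum.atMost_Suc_shift p0 pS by (simp add: algebra_simps sum_subtractf)
    moreover have "(\<Sum>k\<le>N. b k * phi_coeff \<alpha> j (k + i)) = H j i" unfolding H_def M using bN by simp
    moreover have "(\<Sum>k\<le>M. z * b k * phi_coeff \<alpha> j (Suc k + i)) = z * H j (Suc i)"
      unfolding H_def sum_distrib_left by (simp add: mult_ac)
    ultimately show ?case using Suc z by simp
  qed
  define B where "B = (\<lambda>x. \<Sum>k\<le>M. b k * pochhammer x k * pochhammer (x + \<alpha> 0 + of_nat k) (M - k))"
  \<comment> \<open>The \<alpha>_j differ pairwise modulo the integers, so these m(n + 1) = N points
    are distinct, whereas \<open>B\<close> has degree at most M = N - 1.\<close>
  define Z where "Z = (\<lambda>(j, i). \<alpha> j + of_nat i) ` ({1..m} \<times> {..n})"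
  have "B x = 0" for x
  proof (rule poly_fun_eq_0[where f = B and N = M and Z = Z])
    show "poly_fun M B" unfolding B_def by (intro poly_fun_sum poly_fun_pochhammer_basis) auto
    have ne: "\<alpha> i - \<alpha> j \<notin> \<int>" if "i \<in> {1..m}" "j \<in> {1..m}" "i \<noteq> j" for i j
    proof (cases "i < j")
      case True thus ?thesis using dist[of i j] that by auto
    next
      case False
      hence "\<alpha> j - \<alpha> i \<notin> \<int>" using dist[of j i] that by auto
      thus ?thesis by (metis Ints_minus minus_diff_eq)
    qed
    have "inj_on (\<lambda>(j, i). \<alpha> j + of_nat i) ({1..m} \<times> {..n})"
    proof (rule inj_onI, clarify)
      fix j i j' i'
      assume h: "j \<in> {1..m}" "j' \<in> {1..m}" and eq: "\<alpha> j + of_nat i = \<alpha> j' + of_nat i'"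
      have "\<alpha> j - \<alpha> j' = of_nat i' - of_nat i" using eq by (simp add: algebra_simps)
      also have "\<dots> \<in> \<int>" by simp
      finally have "j = j'" using ne[OF h] by blast
      thus "j = j' \<and> i = i'" using eq by simp
    qed
    hence "card Z = m * Suc n" unfolding Z_def by (simp add: card_image card_cartesian_product)
    thus "card Z > M" using N M by simp
    show "finite Z" unfolding Z_def by simp
  next
    fix x assume "x \<in> Z"
    then obtain j i where j: "1 \<le> j" "j \<le> m" "i \<le> n" "x = \<alpha> j + of_nat i" unfolding Z_def by auto
    have "phi_coeff \<alpha> j i / pochhammer (\<alpha> j + of_nat i + \<alpha> 0) M * B x = 0"
      using H[OF j(1,2,3)] unfolding H_def sum_phi_coeff[OF a0 pos[OF j(2)]] B_def j(4) .
    moreover have "phi_coeff \<alpha> j i > 0" using pos j a0 by (intro phi_coeff_pos) auto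
    moreover have "pochhammer (\<alpha> j + of_nat i + \<alpha> 0) M > 0" using pos[of j] j a0
      by (intro pochhammer_pos) (simp add: add_pos_nonneg)
    ultimately show "B x = 0" by simp
  qed
  hence b0: "b k = 0" if "k \<le> M" for k
    using pochhammer_basis_independent[where c = "\<alpha> 0" and M = M and b = b and k = k] a0 that unfolding B_def by blast
  have "p k = 0" if "k \<le> N" for k
  proof (cases k)
    case 0 thus ?thesis using p0 b0[of 0] by simp
  next
    case (Suc k')
    thus ?thesis using pS[of k'] b0[of k'] b0[of k] bN that M by (cases "k = Suc M") auto
  qed
  hence "pochhammer (\<alpha> 0) N * A x = 0" using expand[of x] by simp
  thus ?thesis using pochhammer_pos[OF a0, of N] by simp
qed

text \<open>Each rising factorial vanishes at \<alpha>_j + i for i < n, division by n! keeps the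
  denominators of the values exponential in \<open>n\<close>, and e = 0, ..., m gives m + 1
  independent choices. With these signs the values at -i, which enter \<open>inv_coeff\<close>, are
  nonnegative for positive \<alpha>_j.\<close>

definition aux_poly :: "(nat \<Rightarrow> rat) \<Rightarrow> nat \<Rightarrow> nat \<Rightarrow> nat \<Rightarrow> rat \<Rightarrow> rat" where
  "aux_poly \<alpha> m n e x = (\<Prod>j=1..m. pochhammer (\<alpha> j - x) n / fact n) * (- x) ^ e"

text \<open>
  The common denominator of the Pade approximants is \<open>Q(z) = \<Sum>\<^sub>k approx_coeff \<alpha> m n e k z\<^sup>N\<^sup>-\<^sup>k\<close> with \<open>N = mn + m\<close>.
\<close>

definition approx_coeff :: "(nat \<Rightarrow> rat) \<Rightarrow> nat \<Rightarrow> nat \<Rightarrow> nat \<Rightarrow> nat \<Rightarrow> rat" where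
  "approx_coeff \<alpha> m n e = inv_coeff (\<alpha> 0) (m * n + m) (\<lambda>i. aux_poly \<alpha> m n e (- of_nat i))"

text \<open>This number W equals l_0 Q(a) plus the sum of the l_j P_j(a), where P_j is the part of Q
  \<phi>_j of degree below \<open>N = m * n + m\<close>.\<close>

definition approx_form :: "(nat \<Rightarrow> rat) \<Rightarrow> nat \<Rightarrow> (nat \<Rightarrow> int) \<Rightarrow> int \<Rightarrow> nat \<Rightarrow> nat \<Rightarrow> rat" where
  "approx_form \<alpha> m l a n e =
     (\<Sum>k\<le>m * n + m. approx_coeff \<alpha> m n e k * of_int a ^ (m * n + m - k) * lin_partial \<alpha> m l a k)"

lemma poly_fun_aux_poly:
  assumes "e \<le> m"
  shows "poly_fun (m * n + m) (aux_poly \<alpha> m n e)"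
proof -
  have 1: "poly_fun n (\<lambda>x. pochhammer (\<alpha> j - x) n / fact n)" for j
    using poly_fun_mult[OF poly_fun_const[of 0 "1 / fact n"] poly_fun_pochhammer[of n "\<alpha> j" "-1"]] by simp
  have 2: "poly_fun e (\<lambda>x. (- x) ^ e)" using poly_fun_power[of e 0 "-1"] by simp
  have "poly_fun (card {1..m} * n + e) (\<lambda>x. (\<Prod>j=1..m. pochhammer (\<alpha> j - x) n / fact n) * (- x) ^ e)"
    by (intro poly_fun_mult poly_fun_prod 1 2) auto
  thus ?thesis unfolding aux_poly_def using assms by (auto intro: poly_fun_mono)
qed

lemma aux_poly_eq_0:
  assumes "1 \<le> j" "j \<le> m" "i < n"
  shows "aux_poly \<alpha> m n e (\<alpha> j + of_nat i) = 0"
proof -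
  have "pochhammer (\<alpha> j - (\<alpha> j + of_nat i)) n = 0"
    using assms by (simp add: pochhammer_of_nat_eq_0_lemma)
  hence "(\<Prod>k=1..m. pochhammer (\<alpha> k - (\<alpha> j + of_nat i)) n / fact n) = 0"
    using assms(1,2) by (intro prod_zero bexI[of _ j]) simp_all
  thus ?thesis unfolding aux_poly_def by simp
qed

lemma inv_coeff_sum:
  "(\<Sum>e\<in>E. inv_coeff c N (A e) k * y e) = inv_coeff c N (\<lambda>i. \<Sum>e\<in>E. A e i * y e) k"
  unfolding inv_coeff_def sum_distrib_left sum_distrib_right
  by (subst sum.swap) (simp add: mult_ac)

text \<open>At x = -i the product of rising factorials is a positive factor common to all
  \<open>e\<close>. Cancelling it leaves a polynomial with coefficients \<open>y e\<close> that
  vanishes at every natural number.\<close>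

lemma aux_poly_independent:
  assumes "\<And>j. j \<le> m \<Longrightarrow> \<alpha> j > 0" "\<And>x. (\<Sum>e\<le>m. aux_poly \<alpha> m n e x * y e) = 0" "e \<le> m"
  shows "y e = 0"
proof -
  define q where "q = (\<Sum>e\<le>m. monom (y e) e)"
  have "poly q (of_nat i) = 0" for i
  proof -
    define C where "C = (\<Prod>j=1..m. pochhammer (\<alpha> j + of_nat i) n / fact n)"
    have "(\<Sum>e\<le>m. C * of_nat i ^ e * y e) = 0"
      using assms(2)[of "- of_nat i"] unfolding aux_poly_def C_def by simp
    moreover have "(\<Sum>e\<le>m. C * of_nat i ^ e * y e) = C * poly q (of_nat i)"
      unfolding q_def by (simp add: poly_sum poly_monom sum_distrib_left mult_ac)
    moreover have "C > 0" unfolding C_def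
      using assms(1) by (intro prod_pos) (auto intro!: divide_pos_pos pochhammer_pos add_pos_nonneg)
    ultimately show ?thesis by simp
  qed
  hence "range of_nat \<subseteq> {x. poly q x = 0}" by auto
  moreover have "infinite (range (of_nat :: nat \<Rightarrow> rat))" by (intro range_inj_infinite) (simp add: inj_on_def)
  ultimately have "q = 0" using poly_roots_finite[of q] finite_subset by blast
  hence "coeff q e = 0" by simp
  thus ?thesis using assms(3) unfolding q_def by (simp add: coeff_sum)
qed

text \<open>If all forms vanish, \<open>l\<close> is a left kernel vector of the square matrix
  \<open>C\<close>, whose column \<open>e\<close> lists Q(a), P_1(a), ..., P_m(a). A right kernel
  vector \<open>y\<close> then yields a combination of auxiliary polynomials whose approximants all
  vanish at \<open>a\<close>; it must be 0, against independence.\<close>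

lemma approx_form_nonzero:
  assumes m: "m \<ge> 1"
    and pos: "\<And>j. j \<le> m \<Longrightarrow> \<alpha> j > 0"
    and dist: "\<And>i j. 1 \<le> i \<Longrightarrow> i < j \<Longrightarrow> j \<le> m \<Longrightarrow> \<alpha> i - \<alpha> j \<notin> \<int>"
    and a: "a \<noteq> 0"
    and l: "\<exists>j\<le>m. l j \<noteq> 0"
  shows "\<exists>e\<le>m. approx_form \<alpha> m l a n e \<noteq> 0"
proof (rule ccontr)
  assume "\<not> ?thesis"
  hence W: "approx_form \<alpha> m l a n e = 0" if "e \<le> m" for e using that by blast
  define N where "N = m * n + m"
  define z :: rat where "z = of_int a"
  define f where "f = (\<lambda>j k. if j = 0 then 1 else \<Sum>i<k. phi_coeff \<alpha> j i * z ^ i)"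
  define C where "C = (\<lambda>j e. \<Sum>k\<le>N. approx_coeff \<alpha> m n e k * z ^ (N - k) * f j k)"
  have lin: "lin_partial \<alpha> m l a k = (\<Sum>j\<le>m. of_int (l j) * f j k)" for k
  proof -
    have "(\<Sum>j\<le>m. of_int (l j) * f j k) = of_int (l 0) * f 0 k + (\<Sum>j=1..m. of_int (l j) * f j k)"
      by (simp add: atMost_atLeast0 sum.atLeast_Suc_atMost)
    thus ?thesis unfolding lin_partial_def f_def z_def by (simp cong: sum.cong_simp)
  qed
  have WC: "(\<Sum>j\<le>m. of_int (l j) * C j e) = 0" if "e \<le> m" for e
  proof -
    have "(\<Sum>j\<le>m. of_int (l j) * C j e) = (\<Sum>k\<le>N. approx_coeff \<alpha> m n e k * z ^ (N - k) * lin_partial \<alpha> m l a k)"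
      unfolding C_def lin sum_distrib_left by (subst sum.swap) (simp add: mult_ac)
    also have "\<dots> = approx_form \<alpha> m l a n e" unfolding approx_form_def N_def z_def ..
    finally show ?thesis using W[OF that] by simp
  qed
  obtain j0 where j0: "j0 \<le> m" "l j0 \<noteq> 0" using l by blast
  \<comment> \<open>This enumerates the rows other than \<open>j0\<close>. The \<open>m\<close>
    equations they give have a nontrivial solution, and row \<open>j0\<close> follows because
    \<open>l j0\<close> is nonzero and \<open>l\<close> annihilates \<open>C\<close>.\<close>
  define \<sigma> where "\<sigma> = (\<lambda>i::nat. if i < j0 then i else Suc i)"
  obtain y where y: "\<exists>e\<le>m. y e \<noteq> 0" "\<forall>i<m. (\<Sum>e\<le>m. C (\<sigma> i) e * y e) = 0"
    using homogeneous_system_nontrivial_solution[of m "\<lambda>i. C (\<sigma> i)"] by blast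
  have ne: "(\<Sum>e\<le>m. C j e * y e) = 0" if "j \<le> m" "j \<noteq> j0" for j
  proof -
    define i where "i = (if j < j0 then j else j - 1)"
    have "i < m" "\<sigma> i = j" using that j0 unfolding i_def \<sigma>_def by (auto split: if_splits)
    thus ?thesis using y(2) by blast
  qed
  have Cy: "(\<Sum>e\<le>m. C j e * y e) = 0" if "j \<le> m" for j
  proof (cases "j = j0")
    case True
    have "0 = (\<Sum>e\<le>m. (\<Sum>j\<le>m. of_int (l j) * C j e) * y e)" using WC by simp
    also have "\<dots> = (\<Sum>j\<le>m. of_int (l j) * (\<Sum>e\<le>m. C j e * y e))"
      unfolding sum_distrib_left sum_distrib_right by (subst sum.swap) (simp add: mult_ac)
    also have "\<dots> = (\<Sum>j\<le>m. if j = j0 then of_int (l j0) * (\<Sum>e\<le>m. C j0 e * y e) else 0)"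
      using ne by (intro sum.cong) auto
    also have "\<dots> = of_int (l j0) * (\<Sum>e\<le>m. C j0 e * y e)" using j0 by simp
    finally show ?thesis using j0 True by simp
  qed (use ne that in auto)
  define A where "A = (\<lambda>x. \<Sum>e\<le>m. aux_poly \<alpha> m n e x * y e)"
  define p where "p = inv_coeff (\<alpha> 0) N (\<lambda>i. A (- of_nat i))"
  have p: "p k = (\<Sum>e\<le>m. approx_coeff \<alpha> m n e k * y e)" for k
    unfolding p_def A_def approx_coeff_def N_def inv_coeff_sum ..
  have col: "(\<Sum>k\<le>N. p k * z ^ (N - k) * f j k) = 0" if "j \<le> m" for j
  proof -
    have "(\<Sum>k\<le>N. p k * z ^ (N - k) * f j k) = (\<Sum>e\<le>m. C j e * y e)"
      unfolding C_def p sum_distrib_left sum_distrib_right by (subst sum.swap) (simp add: mult_ac)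
    thus ?thesis using Cy[OF that] by simp
  qed
  have "A x = 0" for x
  proof (rule approximants_have_no_common_zero[OF m pos dist, where A = A and z = z and N = N and n = n and p = p])
    show "poly_fun N A" unfolding A_def N_def
      using poly_fun_mult[OF poly_fun_aux_poly poly_fun_const[of 0]] by (intro poly_fun_sum) fastforce
    show "A (\<alpha> j + of_nat i) = 0" if "1 \<le> j" "j \<le> m" "i < n" for j i
      unfolding A_def using aux_poly_eq_0[OF that] by simp
    show "(\<Sum>k\<le>N. p k * z ^ (N - k)) = 0" using col[of 0] unfolding f_def by simp
    show "(\<Sum>k\<le>N. p k * z ^ (N - k) * (\<Sum>i<k. phi_coeff \<alpha> j i * z ^ i)) = 0" if "1 \<le> j" "j \<le> m" for j
      using col[of j] that unfolding f_def by simp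
  qed (use a in \<open>auto simp: z_def N_def p_def\<close>)
  hence "y e = 0" if "e \<le> m" for e
    using aux_poly_independent[of m \<alpha> n y e] pos that unfolding A_def by blast
  thus False using y(1) by blast
qed

subsection \<open>Denominators of the linear forms\<close>

lemma rat_pos_fraction:
  fixes x :: rat
  assumes "x > 0"
  defines "d \<equiv> nat (snd (quotient_of x))"
  obtains r where "r > 0" "d > 0" "coprime r d" "x = of_nat r / of_nat d"
proof -
  obtain p q where pq: "quotient_of x = (p, q)" by (cases "quotient_of x")
  have q: "q > 0" "coprime p q" "x = of_int p / of_int q"
    using quotient_of_denom_pos[OF pq] quotient_of_coprime[OF pq] quotient_of_div[OF pq] by auto
  have p: "p > 0" using assms(1) q by (simp add: zero_less_divide_iff)
  have d: "q = int d" unfolding d_def pq using q by simp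
  have "coprime (nat p) d" using q(2) p unfolding d
    by (metis coprime_int_iff int_nat_eq order_less_imp_le)
  moreover have "x = of_nat (nat p) / of_nat d" using q(3) p unfolding d by simp
  ultimately show ?thesis using that[of "nat p"] p q(1) d by simp
qed

lemma denominator_dvd:
  assumes "of_nat t * x \<in> \<int>"
  shows "nat (snd (quotient_of x)) dvd t"
proof -
  obtain p q where pq: "quotient_of x = (p, q)" by (cases "quotient_of x")
  have q: "q > 0" "coprime p q" "x = of_int p / of_int q"
    using quotient_of_denom_pos[OF pq] quotient_of_coprime[OF pq] quotient_of_div[OF pq] by auto
  from assms obtain z where "of_nat t * x = of_int z" by (rule Ints_cases)
  hence "(of_int (int t * p) :: rat) = of_int (z * q)" using q by (simp add: field_simps)
  hence "int t * p = z * q" by (simp only: of_int_eq_iff)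
  hence "q dvd int t * p" by simp
  hence "q dvd int t" using q(2) by (simp add: coprime_dvd_mult_left_iff coprime_commute)
  thus ?thesis unfolding pq using q(1) by (simp add: nat_dvd_iff)
qed

section \<open>Divisibilities between the numbers s_j, v_j and d_j\<close>

lemma sden_fraction:
  assumes "\<alpha> j > 0"
  obtains r where "r > 0" "sden \<alpha> j > 0" "\<alpha> j = of_nat r / of_nat (sden \<alpha> j)"
  using rat_pos_fraction[OF assms] unfolding sden_def by metis

lemma vden_fraction:
  assumes "\<alpha> j > 0" "\<alpha> 0 > 0"
  obtains u where "u > 0" "vden \<alpha> j > 0" "coprime u (vden \<alpha> j)" "\<alpha> j + \<alpha> 0 = of_nat u / of_nat (vden \<alpha> j)"
  using rat_pos_fraction[OF add_pos_pos[OF assms]] unfolding vden_def by metis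

lemma vden_dvd:
  assumes "\<alpha> j > 0" "\<alpha> 0 > 0"
  shows "vden \<alpha> j dvd sden \<alpha> 0 * sden \<alpha> j"
proof -
  obtain r r0 where "sden \<alpha> j > 0" "\<alpha> j = of_nat r / of_nat (sden \<alpha> j)"
      "sden \<alpha> 0 > 0" "\<alpha> 0 = of_nat r0 / of_nat (sden \<alpha> 0)"
    using sden_fraction[of \<alpha> j, OF assms(1)] sden_fraction[of \<alpha> 0, OF assms(2)] by metis
  hence "of_nat (sden \<alpha> 0 * sden \<alpha> j) * (\<alpha> j + \<alpha> 0) = of_nat (sden \<alpha> 0 * r + sden \<alpha> j * r0)"
    by (simp add: field_simps)
  thus ?thesis unfolding vden_def by (intro denominator_dvd) (metis Ints_of_nat)
qed

text \<open>\<alpha>_0 is a difference of fractions with denominators v_j and s_j. Hence a prime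
  that divides s_0 but not s_j divides v_j at least as often as s_0.\<close>

lemma sden_0_dvd:
  assumes "\<alpha> j > 0" "\<alpha> 0 > 0"
  shows "sden \<alpha> 0 dvd vden \<alpha> j * sden \<alpha> j"
proof -
  obtain r where r: "sden \<alpha> j > 0" "\<alpha> j = of_nat r / of_nat (sden \<alpha> j)"
    using sden_fraction[of \<alpha> j, OF assms(1)] by metis
  obtain u where u: "vden \<alpha> j > 0" "\<alpha> j + \<alpha> 0 = of_nat u / of_nat (vden \<alpha> j)"
    using vden_fraction[of \<alpha> j, OF assms] by metis
  have "\<alpha> 0 = of_nat u / of_nat (vden \<alpha> j) - of_nat r / of_nat (sden \<alpha> j)" using r u by simp
  hence "of_nat (vden \<alpha> j * sden \<alpha> j) * \<alpha> 0 = of_int (int (sden \<alpha> j * u) - int (vden \<alpha> j * r))"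
    using r(1) u(1) by (simp add: field_simps)
  thus ?thesis unfolding sden_def[of \<alpha> 0] by (intro denominator_dvd) (metis Ints_of_int)
qed

lemma d_lcm_pos:
  assumes "\<And>j. j \<le> m \<Longrightarrow> \<alpha> j > 0"
  shows "d_lcm \<alpha> m > 0"
proof -
  have "dfac \<alpha> j \<noteq> 0" if "j \<in> {1..m}" for j
  proof -
    have "\<alpha> j > 0" "\<alpha> 0 > 0" using assms that by auto
    thus ?thesis using vden_dvd[of \<alpha> j] sden_fraction[of \<alpha> j] sden_fraction[of \<alpha> 0]
      unfolding dfac_def by (metis dvd_div_eq_0_iff mult_is_0 less_irrefl)
  qed
  hence "0 \<notin> dfac \<alpha> ` {1..m}" by force
  thus ?thesis unfolding d_lcm_def by (auto simp: Lcm_0_iff intro!: gr0I)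
qed

lemma d_tilde_pos:
  assumes "\<And>j. j \<le> m \<Longrightarrow> \<alpha> j > 0"
  shows "d_tilde \<alpha> m > 0"
  using d_lcm_pos[of m \<alpha>] assms unfolding d_tilde_def
  by (auto intro!: gr0I simp: dvd_div_eq_0_iff)

text \<open>After multiplication by s_0 this follows from s_0 s_j = d_j v_j, since d_j divides d and
  d = g \<open>d_tilde\<close> for a divisor g of s_0. It lets powers of \<open>d_tilde\<close>
  clear the powers of v_j/s_j in the coefficients of \<phi>_j.\<close>

lemma sden_dvd:
  assumes pos: "\<And>j. j \<le> m \<Longrightarrow> \<alpha> j > 0" and j: "1 \<le> j" "j \<le> m"
  shows "sden \<alpha> j dvd d_tilde \<alpha> m * vden \<alpha> j"
proof -
  have "\<alpha> j > 0" "\<alpha> 0 > 0" using pos j by auto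
  hence s0: "sden \<alpha> 0 > 0" and dj: "dfac \<alpha> j * vden \<alpha> j = sden \<alpha> 0 * sden \<alpha> j"
    using vden_dvd[of \<alpha> j] sden_fraction[of \<alpha> 0] unfolding dfac_def by (metis, simp)
  define g where "g = gcd (d_lcm \<alpha> m) (sden \<alpha> 0)"
  obtain s' where s': "sden \<alpha> 0 = g * s'" unfolding g_def by (metis dvdE gcd_dvd2)
  have dt: "d_tilde \<alpha> m * g = d_lcm \<alpha> m" unfolding d_tilde_def g_def by simp
  have "dfac \<alpha> j dvd d_lcm \<alpha> m" unfolding d_lcm_def using j by (intro dvd_Lcm) auto
  then obtain w where w: "d_lcm \<alpha> m = dfac \<alpha> j * w" by (rule dvdE)
  have "sden \<alpha> 0 * (d_tilde \<alpha> m * vden \<alpha> j) = s' * (d_tilde \<alpha> m * g) * vden \<alpha> j" unfolding s' by simp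
  also have "\<dots> = s' * w * (dfac \<alpha> j * vden \<alpha> j)" unfolding dt w by simp
  also have "\<dots> = sden \<alpha> 0 * (s' * w * sden \<alpha> j)" unfolding dj by simp
  finally have "d_tilde \<alpha> m * vden \<alpha> j = s' * w * sden \<alpha> j" using s0 by simp
  thus ?thesis by simp
qed

lemma s_lcm_pos:
  assumes "\<And>j. j \<le> m \<Longrightarrow> \<alpha> j > 0"
  shows "s_lcm \<alpha> m > 0"
proof -
  have "sden \<alpha> j \<noteq> 0" if "j \<in> {1..m}" for j
    using sden_fraction[of \<alpha> j] assms that by (metis atLeastAtMost_iff less_irrefl)
  hence "0 \<notin> sden \<alpha> ` {1..m}" by force
  thus ?thesis unfolding s_lcm_def by (auto simp: Lcm_0_iff intro!: gr0I)
qed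

lemma sden_dvd_s_lcm: "1 \<le> j \<Longrightarrow> j \<le> m \<Longrightarrow> sden \<alpha> j dvd s_lcm \<alpha> m"
  unfolding s_lcm_def by (intro dvd_Lcm) auto

section \<open>Common denominators of the coefficients\<close>

lemma Ints_mult_dvd:
  fixes x :: rat
  assumes "of_nat t * x \<in> \<int>" "t dvd T"
  shows "of_nat T * x \<in> \<int>"
proof -
  obtain w where "T = t * w" using assms(2) by (rule dvdE)
  hence "of_nat T * x = of_nat w * (of_nat t * x)" by simp
  also have "\<dots> \<in> \<int>" by (intro Ints_mult[OF _ assms(1)]) auto
  finally show ?thesis .
qed

lemma Ints_mult_mult:
  fixes x y :: rat
  assumes "of_nat t * x \<in> \<int>" "of_nat u * y \<in> \<int>"
  shows "of_nat (t * u) * (x * y) \<in> \<int>"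
proof -
  have "of_nat (t * u) * (x * y) = (of_nat t * x) * (of_nat u * y)" by simp
  also have "\<dots> \<in> \<int>" by (rule Ints_mult[OF assms])
  finally show ?thesis .
qed

lemma pochhammer_div_fact_denominator:
  fixes r :: int
  assumes "s > 0" "S > 0" "s dvd S"
  shows "of_nat (s ^ k * fact_part S k) * (pochhammer (of_int r / of_nat s :: rat) k / fact k) \<in> \<int>"
proof -
  obtain z where z: "int (fact_part S k) * (\<Prod>t<k. r + int s * int t) = fact k * z"
    using fact_dvd_fact_part_mult_progression[OF assms(2,3), of k r] by (rule dvdE)
  have "of_nat (s ^ k * fact_part S k) * (pochhammer (of_int r / of_nat s :: rat) k / fact k)
      = of_nat (fact_part S k) * (of_nat s ^ k * pochhammer (of_int r / of_nat s) k) / fact k" by simp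
  also have "\<dots> = of_int (int (fact_part S k) * (\<Prod>t<k. r + int s * int t)) / fact k"
    unfolding pochhammer_progression[OF assms(1)] by simp
  also have "\<dots> = of_int z" unfolding z by simp
  finally show ?thesis by simp
qed

text \<open>The factors with s_0 clear the Pochhammer quotients of \<open>inv_coeff\<close>, the
  others the values of \<open>aux_poly\<close> at the points -i.\<close>

definition approx_denom :: "(nat \<Rightarrow> rat) \<Rightarrow> nat \<Rightarrow> nat \<Rightarrow> nat" where
  "approx_denom \<alpha> m n = sden \<alpha> 0 ^ (m * n + m) * fact_part (sden \<alpha> 0) (m * n + m)
     * ((\<Prod>j=1..m. sden \<alpha> j ^ n) * fact_part (s_lcm \<alpha> m) n ^ m)"

text \<open>A common denominator of the coefficients of all \<phi>_j up to index \<open>N\<close>,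
  provided that \<open>X\<close> bounds the terms of the progressions u_j + v_j t occurring in their
  denominators.\<close>

definition phi_denom :: "(nat \<Rightarrow> rat) \<Rightarrow> nat \<Rightarrow> nat \<Rightarrow> nat \<Rightarrow> nat" where
  "phi_denom \<alpha> m N X = d_tilde \<alpha> m ^ N * fact_part (s_lcm \<alpha> m) N * Lcm {1..X}"

lemma approx_denom_mult:
  assumes pos: "\<And>j. j \<le> m \<Longrightarrow> \<alpha> j > 0" and k: "k \<le> m * n + m"
  shows "of_nat (approx_denom \<alpha> m n) * approx_coeff \<alpha> m n e k \<in> \<int>"
proof -
  define N where "N = m * n + m"
  define s0 where "s0 = sden \<alpha> 0"
  obtain r0 where r0: "s0 > 0" "\<alpha> 0 = of_nat r0 / of_nat s0"
    using sden_fraction[of \<alpha> 0] pos[of 0] unfolding s0_def by (metis le0)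
  have aux: "of_nat ((\<Prod>j=1..m. sden \<alpha> j ^ n) * fact_part (s_lcm \<alpha> m) n ^ m) * aux_poly \<alpha> m n e (- of_nat i) \<in> \<int>" for i
  proof -
    have "of_nat ((\<Prod>j=1..m. sden \<alpha> j ^ n) * fact_part (s_lcm \<alpha> m) n ^ m) * aux_poly \<alpha> m n e (- of_nat i)
        = (\<Prod>j=1..m. of_nat (sden \<alpha> j ^ n * fact_part (s_lcm \<alpha> m) n) * (pochhammer (\<alpha> j + of_nat i) n / fact n)) * of_nat i ^ e"
      unfolding aux_poly_def
      by (simp only: prod.distrib of_nat_mult of_nat_prod of_nat_power prod_constant card_atLeastAtMost) (simp add: mult_ac)
    also have "\<dots> \<in> \<int>"
    proof (rule Ints_mult[OF Ints_prod])
      fix j assume j: "j \<in> {1..m}"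
      obtain r where r: "sden \<alpha> j > 0" "\<alpha> j = of_nat r / of_nat (sden \<alpha> j)"
        using sden_fraction[of \<alpha> j] pos j by (metis atLeastAtMost_iff)
      have "\<alpha> j + of_nat i = of_int (int (r + i * sden \<alpha> j)) / of_nat (sden \<alpha> j)"
        using r by (simp add: field_simps)
      thus "of_nat (sden \<alpha> j ^ n * fact_part (s_lcm \<alpha> m) n) * (pochhammer (\<alpha> j + of_nat i) n / fact n) \<in> \<int>"
        using pochhammer_div_fact_denominator[OF r(1) s_lcm_pos[of m \<alpha>], of n "int (r + i * sden \<alpha> j)"]
          sden_dvd_s_lcm[of j m \<alpha>] pos j by simp
    qed auto
    finally show ?thesis .
  qed
  have head: "of_nat (s0 ^ N * fact_part s0 N)
      * (pochhammer (\<alpha> 0 - 1) (k - i) / fact (k - i) * (pochhammer (1 - \<alpha> 0 - of_nat N) i / fact i)) \<in> \<int>" if "i \<le> k" for i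
  proof (rule Ints_mult_dvd)
    have e1: "\<alpha> 0 - 1 = of_int (int r0 - int s0) / of_nat s0"
      and e2: "1 - \<alpha> 0 - of_nat N = of_int (int s0 - int r0 - int N * int s0) / of_nat s0"
      using r0 by (simp_all add: field_simps)
    show "of_nat (s0 ^ (k - i) * fact_part s0 (k - i) * (s0 ^ i * fact_part s0 i))
      * (pochhammer (\<alpha> 0 - 1) (k - i) / fact (k - i) * (pochhammer (1 - \<alpha> 0 - of_nat N) i / fact i)) \<in> \<int>"
      unfolding e1 e2 using r0 by (intro Ints_mult_mult pochhammer_div_fact_denominator) auto
    \<comment> \<open>The lengths of the two Pochhammer quotients add up to k \<le> N, so one factor
      of length \<open>N\<close> clears both.\<close>
    have "fact_part s0 (k - i) * fact_part s0 i dvd fact_part s0 (k - i + i)" by (rule fact_part_mult_dvd)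
    also have "\<dots> dvd fact_part s0 N" using that k by (intro fact_part_mono) (simp add: N_def)
    finally have "fact_part s0 (k - i) * fact_part s0 i dvd fact_part s0 N" .
    moreover have "s0 ^ (k - i) * s0 ^ i dvd s0 ^ N"
      unfolding power_add[symmetric] using that k by (intro le_imp_power_dvd) (simp add: N_def)
    ultimately have "s0 ^ (k - i) * s0 ^ i * (fact_part s0 (k - i) * fact_part s0 i) dvd s0 ^ N * fact_part s0 N"
      by (intro mult_dvd_mono)
    thus "s0 ^ (k - i) * fact_part s0 (k - i) * (s0 ^ i * fact_part s0 i) dvd s0 ^ N * fact_part s0 N"
      by (simp add: mult_ac)
  qed
  show ?thesis
    unfolding approx_coeff_def inv_coeff_def approx_denom_def N_def[symmetric] s0_def[symmetric] sum_distrib_left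
    by (intro Ints_sum Ints_mult_mult head aux) auto
qed

text \<open>The coefficient is v^i R/(s^i U) with products \<open>R\<close> and \<open>U\<close>
  over progressions. As \<open>s\<close> divides \<open>d_tilde\<close> v, i! divides
  \<open>E * R\<close>, and \<open>U\<close> divides \<open>L * fact i\<close>, the factorials
  cancel and an integer remains.\<close>

lemma phi_denom_mult:
  assumes pos: "\<And>j. j \<le> m \<Longrightarrow> \<alpha> j > 0" and j: "1 \<le> j" "j \<le> m" and i: "i \<le> N"
    and X: "\<And>u. \<alpha> j + \<alpha> 0 = of_nat u / of_nat (vden \<alpha> j) \<Longrightarrow> u + vden \<alpha> j * N \<le> X"
  shows "of_nat (phi_denom \<alpha> m N X) * phi_coeff \<alpha> j i \<in> \<int>"
proof (rule Ints_mult_dvd)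
  define s where "s = sden \<alpha> j"
  define v where "v = vden \<alpha> j"
  define E where "E = fact_part (s_lcm \<alpha> m) i"
  define L where "L = Lcm {1..X}"
  have p: "\<alpha> j > 0" "\<alpha> 0 > 0" using pos j by auto
  obtain r where r: "s > 0" "\<alpha> j = of_nat r / of_nat s"
    using sden_fraction[of \<alpha> j] p unfolding s_def by metis
  obtain u where u: "u > 0" "v > 0" "coprime u v" "\<alpha> j + \<alpha> 0 = of_nat u / of_nat v"
    using vden_fraction[of \<alpha> j] p unfolding v_def by metis
  define R where "R = (\<Prod>t<i. int r + int s * int t)"
  define U where "U = (\<Prod>t<i. u + v * t)"
  have U0: "U > 0" unfolding U_def using u by (intro prod_pos) auto
  obtain K where K: "d_tilde \<alpha> m * v = s * K"
    using sden_dvd[of m \<alpha>, OF pos j] unfolding s_def v_def by (auto elim: dvdE)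
  have "u + v * N \<le> X" using X[of u] u(4) unfolding v_def by blast
  hence "U dvd L * fact i" unfolding U_def L_def using u i
    by (intro progression_dvd_Lcm_mult_fact) (auto intro: order_trans[rotated])
  then obtain z2 where z2: "L * fact i = U * z2" by (rule dvdE)
  have "fact i dvd int E * R" unfolding E_def R_def
    using s_lcm_pos[of m \<alpha>] pos sden_dvd_s_lcm[OF j] s_def by (intro fact_dvd_fact_part_mult_progression) auto
  then obtain z1 where z1: "int E * R = fact i * z1" by (rule dvdE)
  have R: "of_nat s ^ i * pochhammer (\<alpha> j) i = of_int R"
    using pochhammer_progression[OF r(1), of i "int r"] unfolding R_def r(2) by simp
  have U: "of_nat v ^ i * pochhammer (\<alpha> j + \<alpha> 0) i = of_nat U"
    using pochhammer_progression[OF u(2), of i "int u"] unfolding U_def u(4) by simp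
  have phi: "of_nat U * of_nat s ^ i * phi_coeff \<alpha> j i = of_nat v ^ i * of_int R"
  proof -
    have "pochhammer (\<alpha> j + \<alpha> 0) i > 0" using p by (intro pochhammer_pos) simp
    thus ?thesis unfolding phi_coeff_def U[symmetric] R[symmetric] by simp
  qed
  have "of_nat U * of_nat s ^ i * (of_nat (d_tilde \<alpha> m ^ i * E * L) * phi_coeff \<alpha> j i)
      = of_nat (d_tilde \<alpha> m ^ i * E * L) * (of_nat v ^ i * of_int R)"
    using phi by simp
  also have "\<dots> = of_nat ((d_tilde \<alpha> m * v) ^ i) * of_nat L * of_int (int E * R)"
    by (simp add: power_mult_distrib)
  also have "\<dots> = of_nat s ^ i * of_nat (K ^ i) * of_nat (L * fact i) * of_int z1"
    unfolding K z1 by (simp add: power_mult_distrib)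
  also have "\<dots> = of_nat U * of_nat s ^ i * (of_nat (K ^ i) * of_nat z2 * of_int z1)"
    unfolding z2 by simp
  finally have "of_nat (d_tilde \<alpha> m ^ i * E * L) * phi_coeff \<alpha> j i = of_nat (K ^ i) * of_nat z2 * of_int z1"
    using U0 r(1) by simp
  thus "of_nat (d_tilde \<alpha> m ^ i * E * L) * phi_coeff \<alpha> j i \<in> \<int>" by simp
  show "d_tilde \<alpha> m ^ i * E * L dvd phi_denom \<alpha> m N X"
    unfolding phi_denom_def E_def L_def using i by (intro mult_dvd_mono le_imp_power_dvd fact_part_mono) auto
qed

lemma approx_form_denominator:
  assumes pos: "\<And>j. j \<le> m \<Longrightarrow> \<alpha> j > 0"
    and X: "\<And>j u. 1 \<le> j \<Longrightarrow> j \<le> m \<Longrightarrow> \<alpha> j + \<alpha> 0 = of_nat u / of_nat (vden \<alpha> j) \<Longrightarrow> u + vden \<alpha> j * (m * n + m) \<le> X"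
  shows "of_nat (approx_denom \<alpha> m n * phi_denom \<alpha> m (m * n + m) X) * approx_form \<alpha> m l a n e \<in> \<int>"
proof -
  define N where "N = m * n + m"
  have lin: "of_nat (phi_denom \<alpha> m N X) * lin_partial \<alpha> m l a k \<in> \<int>" if "k \<le> N" for k
  proof -
    have "of_nat (phi_denom \<alpha> m N X) * lin_partial \<alpha> m l a k = of_nat (phi_denom \<alpha> m N X) * of_int (l 0)
      + (\<Sum>j=1..m. of_int (l j) * (\<Sum>i<k. (of_nat (phi_denom \<alpha> m N X) * phi_coeff \<alpha> j i) * of_int a ^ i))"
      unfolding lin_partial_def by (simp add: algebra_simps sum_distrib_left)
    also have "\<dots> \<in> \<int>"
      using that X by (intro Ints_add Ints_sum Ints_mult[OF Ints_of_int] Ints_mult[OF Ints_of_nat] Ints_mult[OF phi_denom_mult] pos)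
         (auto simp: N_def)
    finally show ?thesis .
  qed
  have "of_nat (approx_denom \<alpha> m n * phi_denom \<alpha> m N X) * approx_form \<alpha> m l a n e
     = (\<Sum>k\<le>N. of_int a ^ (N - k) * ((of_nat (approx_denom \<alpha> m n) * approx_coeff \<alpha> m n e k) * (of_nat (phi_denom \<alpha> m N X) * lin_partial \<alpha> m l a k)))"
    unfolding approx_form_def N_def sum_distrib_left by (intro sum.cong) (auto simp: mult_ac)
  also have "\<dots> \<in> \<int>"
    using pos by (intro Ints_sum Ints_mult[OF Ints_power] Ints_mult[OF approx_denom_mult lin]) (auto simp: N_def)
  finally show ?thesis unfolding N_def .
qed

subsection \<open>Divisibility of the linear forms at the primes dividing the argument\<close>

lemma not_dvd_fact_part:
  assumes "prime p" "\<not> p dvd s"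
  shows "\<not> p dvd fact_part s k"
proof -
  have "multiplicity p (fact_part s k) = 0"
    using assms by (simp add: multiplicity_fact_part in_prime_factors_iff)
  thus ?thesis using fact_part_pos[of s k] assms(1)
    by (metis prime_multiplicity_gt_zero_iff less_irrefl prime_imp_prime_elem neq0_conv)
qed

lemma p_integral_cancel_nat:
  assumes "prime p" "p_integral p (of_nat d * x)" "\<not> p dvd d"
  shows "p_integral p x"
proof -
  have "p_integral p (of_nat d * x / of_int (int d))"
    using assms by (intro p_integral_divide_unit) auto
  moreover have "d \<noteq> 0" using assms(3) by (metis dvd_0_right)
  ultimately show ?thesis by simp
qed

lemma p_integral_pochhammer_div_fact:
  fixes r :: int
  assumes "prime p" "\<not> p dvd s" "s > 0"
  shows "p_integral p (pochhammer (of_int r / of_nat s) k / fact k)"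
proof (rule p_integral_cancel_nat[OF assms(1)])
  show "p_integral p (of_nat (s ^ k * fact_part s k) * (pochhammer (of_int r / of_nat s) k / fact k))"
    using assms by (intro p_integral_Ints pochhammer_div_fact_denominator) auto
  show "\<not> p dvd s ^ k * fact_part s k"
    using assms not_dvd_fact_part[of p s k] by (auto simp: prime_dvd_mult_iff dest: prime_dvd_power)
qed

text \<open>(N + i)!/i! is a product of \<open>N\<close> consecutive integers, so the divisibility
  for progressions applies with difference 1.\<close>

lemma fact_mult_fact_div_fact_add:
  assumes "N + i \<le> Y"
  shows "of_nat (Lcm {1..Y}) * (fact N * fact i / fact (N + i) :: rat) \<in> \<int>"
proof -
  define P where "P = (\<Prod>t<N. Suc i + 1 * t)"
  have "P dvd Lcm {1..Y} * fact N" unfolding P_def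
    using assms by (intro progression_dvd_Lcm_mult_fact) auto
  then obtain w where w: "Lcm {1..Y} * fact N = P * w" by (rule dvdE)
  have "(fact (N + i) :: rat) = fact i * pochhammer (1 + of_nat i) N"
    using pochhammer_product'[of "1 :: rat" i N] by (simp add: pochhammer_fact add.commute)
  moreover have "pochhammer (1 + of_nat i :: rat) N = of_nat P"
    unfolding P_def by (simp add: pochhammer_prod atLeast0LessThan add_ac)
  ultimately have f: "(fact (N + i) :: rat) = fact i * of_nat P" by simp
  have "P > 0" unfolding P_def by (intro prod_pos) auto
  hence "of_nat (Lcm {1..Y}) * (fact N * fact i / fact (N + i) :: rat) = of_nat (Lcm {1..Y} * fact N) / of_nat P"
    unfolding f by simp
  also have "\<dots> = of_nat w" unfolding w using \<open>P > 0\<close> by simp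
  finally show ?thesis by simp
qed

text \<open>This is the coefficient of \<open>z\<^sup>N\<^sup>+\<^sup>i\<close> in \<open>Q(z) \<phi>\<^sub>j(z)\<close>.\<close>

definition remainder_coeff :: "(nat \<Rightarrow> rat) \<Rightarrow> nat \<Rightarrow> nat \<Rightarrow> nat \<Rightarrow> nat \<Rightarrow> nat \<Rightarrow> rat" where
  "remainder_coeff \<alpha> m n e j i = (\<Sum>k\<le>m * n + m. approx_coeff \<alpha> m n e k * phi_coeff \<alpha> j (k + i))"

text \<open>The expansion of \<open>aux_poly\<close> is evaluated at \<alpha>_j + i. Its zeros there
  for i < n make Q \<phi>_j - P_j vanish to order N + n at 0.\<close>

lemma remainder_coeff_eq:
  fixes \<alpha> :: "nat \<Rightarrow> rat" and m n :: nat
  assumes "\<alpha> 0 > 0" "\<alpha> j > 0" "e \<le> m"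
  defines "N \<equiv> m * n + m"
  shows "remainder_coeff \<alpha> m n e j i
    = pochhammer (\<alpha> 0) N * pochhammer (\<alpha> j) i / pochhammer (\<alpha> j + \<alpha> 0) (N + i) * aux_poly \<alpha> m n e (\<alpha> j + of_nat i)"
proof -
  have "pochhammer (\<alpha> j + \<alpha> 0) (N + i) = pochhammer (\<alpha> j + \<alpha> 0) i * pochhammer (\<alpha> j + of_nat i + \<alpha> 0) N"
    using pochhammer_product'[of "\<alpha> j + \<alpha> 0" i N] by (simp add: add_ac)
  thus ?thesis
    unfolding remainder_coeff_def sum_phi_coeff[of \<alpha> j, OF assms(1,2)] approx_coeff_def
      inv_coeff_expansion[OF poly_fun_aux_poly[OF assms(3)]]
    unfolding phi_coeff_def N_def by simp
qed

lemma remainder_coeff_eq_0: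
  assumes "\<alpha> 0 > 0" "\<alpha> j > 0" "e \<le> m" "1 \<le> j" "j \<le> m" "i < n"
  shows "remainder_coeff \<alpha> m n e j i = 0"
  using remainder_coeff_eq[of \<alpha> j e m, OF assms(1-3)] aux_poly_eq_0[OF assms(4-6)] by simp

text \<open>In the closed form, the value of \<open>aux_poly\<close> is p-integral because
  \<open>p\<close> divides no s_k with k \<ge> 1. For the Pochhammer quotient two factors
  \<open>L\<close> suffice if \<open>p\<close> does not divide s_0; otherwise the powers of v_j
  compensate those of s_0.\<close>

lemma p_integral_remainder_coeff:
  assumes pos: "\<And>j. j \<le> m \<Longrightarrow> \<alpha> j > 0" and j: "1 \<le> j" "j \<le> m" and e: "e \<le> m"
    and p: "prime p" "\<not> p dvd s_lcm \<alpha> m"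
    and Y: "\<And>u. \<alpha> j + \<alpha> 0 = of_nat u / of_nat (vden \<alpha> j) \<Longrightarrow> u + vden \<alpha> j * (m * n + m + i) \<le> Y"
  shows "p_integral p (of_nat (Lcm {1..Y}) ^ 2 * remainder_coeff \<alpha> m n e j i)"
proof -
  define N where "N = m * n + m"
  define L where "L = Lcm {1..Y}"
  have a: "\<alpha> 0 > 0" "\<alpha> j > 0" using pos j by auto
  obtain r0 where r0: "sden \<alpha> 0 > 0" "\<alpha> 0 = of_nat r0 / of_nat (sden \<alpha> 0)"
    using sden_fraction[of \<alpha> 0] a by metis
  define s where "s = sden \<alpha> j"
  define v where "v = vden \<alpha> j"
  have sd: "\<not> p dvd sden \<alpha> k" if "1 \<le> k" "k \<le> m" for k
    using p sden_dvd_s_lcm[OF that] by (meson dvd_trans)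
  have ps: "\<not> p dvd s" using sd j s_def by auto
  obtain r where r: "s > 0" "\<alpha> j = of_nat r / of_nat s"
    using sden_fraction[of \<alpha> j] a unfolding s_def by metis
  obtain u where u: "u > 0" "v > 0" "coprime u v" "\<alpha> j + \<alpha> 0 = of_nat u / of_nat v"
    using vden_fraction[of \<alpha> j] a unfolding v_def by metis
  have Yu: "u + v * (N + i) \<le> Y" using Y[of u] u(4) unfolding v_def N_def by blast
  have "N + i \<le> v * (N + i)" using u(2) by (cases v) auto
  hence YN: "N + i \<le> Y" using Yu by linarith
  have aj: "p_integral p (pochhammer (\<alpha> j) i / fact i)"
    using p_integral_pochhammer_div_fact[OF p(1) ps r(1), of "int r" i] r(2) by simp
  have aux: "p_integral p (aux_poly \<alpha> m n e (\<alpha> j + of_nat i))"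
    unfolding aux_poly_def
  proof (intro p_integral_mult p_integral_prod p_integral_power p(1))
    fix k assume k: "k \<in> {1..m}"
    define s' where "s' = sden \<alpha> k"
    obtain r' where r': "s' > 0" "\<alpha> k = of_nat r' / of_nat s'"
      using sden_fraction[of \<alpha> k] pos[of k] k unfolding s'_def by (metis atLeastAtMost_iff)
    have "\<not> p dvd s' * s" using sd[of k] k ps p(1) s'_def by (simp add: prime_dvd_mult_iff)
    moreover have "\<alpha> k - (\<alpha> j + of_nat i) = of_int (int r' * int s - int r * int s' - int i * int s * int s') / of_nat (s' * s)"
      unfolding r r' using r(1) r'(1) by (simp add: field_simps)
    moreover have "s' * s > 0" using r(1) r'(1) by simp
    ultimately show "p_integral p (pochhammer (\<alpha> k - (\<alpha> j + of_nat i)) n / fact n)"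
      by (simp only: p_integral_pochhammer_div_fact[OF p(1)] not_False_eq_True)
  next
    have "p_integral p (of_int (- int r - int i * int s) / of_int (int s))"
      using ps p(1) by (intro p_integral_divide_unit p_integral_of_int) auto
    moreover have "- (\<alpha> j + of_nat i) = of_int (- int r - int i * int s) / of_int (int s)"
      unfolding r using r(1) by (simp add: field_simps)
    ultimately show "p_integral p (- (\<alpha> j + of_nat i))" by simp
  qed
  define U where "U = (\<Prod>t<N + i. u + v * t)"
  have U0: "U > 0" unfolding U_def using u by (intro prod_pos) auto
  have U: "of_nat v ^ (N + i) * pochhammer (\<alpha> j + \<alpha> 0) (N + i) = of_nat U"
    using pochhammer_progression[OF u(2), of "N + i" "int u"] unfolding U_def u(4) by simp
  hence poch: "pochhammer (\<alpha> j + \<alpha> 0) (N + i) = of_nat U / of_nat v ^ (N + i)"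
    using u(2) by (simp add: field_simps)
  have main: "p_integral p (of_nat L ^ 2 * (pochhammer (\<alpha> 0) N * pochhammer (\<alpha> j) i / pochhammer (\<alpha> j + \<alpha> 0) (N + i)))"
  proof (cases "p dvd sden \<alpha> 0")
    case False
    have a0: "p_integral p (pochhammer (\<alpha> 0) N / fact N)"
      using p_integral_pochhammer_div_fact[OF p(1) False r0(1), of "int r0" N] r0(2) by simp
    have b: "p_integral p (of_nat L * (fact N * fact i / fact (N + i)))"
      unfolding L_def by (intro p_integral_Ints p fact_mult_fact_div_fact_add YN)
    have c: "p_integral p (of_nat L * fact (N + i) / pochhammer (\<alpha> j + \<alpha> 0) (N + i))"
    proof -
      have "U dvd L * fact (N + i)" unfolding U_def L_def
      proof (rule progression_dvd_Lcm_mult_fact[OF u(1-3)])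
        fix t assume "t < N + i"
        hence "v * t \<le> v * (N + i)" by simp
        thus "u + v * t \<le> Y" using Yu by linarith
      qed
      then obtain w where w: "L * fact (N + i) = U * w" by (rule dvdE)
      have "of_nat L * fact (N + i) / pochhammer (\<alpha> j + \<alpha> 0) (N + i) = of_nat (L * fact (N + i)) * of_nat v ^ (N + i) / of_nat U"
        unfolding poch by simp
      also have "\<dots> = of_nat (w * v ^ (N + i))" unfolding w using U0 by simp
      finally show ?thesis using p by (metis p_integral_of_nat)
    qed
    \<comment> \<open>Inserting N!, i! and (N + i)! splits the quotient into four p-integral pieces,
      the last two of which use up one factor \<open>L\<close> each.\<close>
    have "of_nat L ^ 2 * (pochhammer (\<alpha> 0) N * pochhammer (\<alpha> j) i / pochhammer (\<alpha> j + \<alpha> 0) (N + i))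
      = (pochhammer (\<alpha> 0) N / fact N) * (pochhammer (\<alpha> j) i / fact i) * (of_nat L * (fact N * fact i / fact (N + i)))
        * (of_nat L * fact (N + i) / pochhammer (\<alpha> j + \<alpha> 0) (N + i))"
      by (simp add: power2_eq_square)
    also have "p_integral p \<dots>" by (intro p_integral_mult p a0 aj b c)
    finally show ?thesis .
  next
    case True
    \<comment> \<open>Now \<open>p\<close> divides \<open>v\<close>, since it divides s_0 but not
      \<open>s\<close>. So every factor u + v t of \<open>U\<close> is prime to \<open>p\<close>,
      and v = s_0 (w/s) lets v^N absorb the denominator s_0^N of (\<alpha>_0)_N.\<close>
    obtain w where w: "v * s = sden \<alpha> 0 * w" using sden_0_dvd[of \<alpha> j] a unfolding v_def s_def by (auto elim: dvdE)
    hence "p dvd v * s" using True by simp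
    hence pv: "p dvd v" using ps p(1) by (simp add: prime_dvd_mult_iff)
    hence "\<not> p dvd u" using u(3) p(1) by (metis coprime_common_divisor not_prime_unit)
    hence "\<not> p dvd u + v * t" for t using pv by (simp add: dvd_add_left_iff)
    hence pU: "\<not> int p dvd int U" unfolding U_def using p(1) by (simp only: int_dvd_int_iff) (auto simp: prime_dvd_prod_iff)
    define R where "R = (\<Prod>t<N. int r0 + int (sden \<alpha> 0) * int t)"
    have R: "of_nat (sden \<alpha> 0) ^ N * pochhammer (\<alpha> 0) N = of_int R"
      using pochhammer_progression[OF r0(1), of N "int r0"] r0(2) unfolding R_def by simp
    have vs: "of_nat v = of_nat (sden \<alpha> 0) * (of_nat w / of_nat s :: rat)"
      using w r(1) by (metis of_nat_eq_0_iff of_nat_mult nonzero_eq_divide_eq times_divide_eq_right less_irrefl)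
    have ws: "p_integral p (of_nat w / of_int (int s))" using p ps by (intro p_integral_divide_unit) auto
    have fi: "p_integral p (fact i * (pochhammer (\<alpha> j) i / fact i))"
      using p aj p_integral_of_nat[of p "fact i"] by (intro p_integral_mult) auto
    have "of_nat L ^ 2 * (pochhammer (\<alpha> 0) N * pochhammer (\<alpha> j) i / pochhammer (\<alpha> j + \<alpha> 0) (N + i))
       = of_nat L ^ 2 * (fact i * (pochhammer (\<alpha> j) i / fact i)) * of_nat v ^ i * (of_nat v ^ N * pochhammer (\<alpha> 0) N) / of_int (int U)"
      unfolding poch by (simp add: power_add)
    also have "of_nat v ^ N * pochhammer (\<alpha> 0) N = (of_nat w / of_int (int s)) ^ N * of_int R"
      unfolding R[symmetric] vs by (simp add: power_mult_distrib power_divide)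
    also have "p_integral p (of_nat L ^ 2 * (fact i * (pochhammer (\<alpha> j) i / fact i)) * of_nat v ^ i * ((of_nat w / of_int (int s)) ^ N * of_int R) / of_int (int U))"
      using p by (intro p_integral_divide_unit pU p_integral_mult p_integral_power ws fi) auto
    finally show ?thesis .
  qed
  have "p_integral p (of_nat L ^ 2 * (pochhammer (\<alpha> 0) N * pochhammer (\<alpha> j) i / pochhammer (\<alpha> j + \<alpha> 0) (N + i))
      * aux_poly \<alpha> m n e (\<alpha> j + of_nat i))"
    by (intro p_integral_mult p main aux)
  thus ?thesis unfolding remainder_coeff_eq[of \<alpha> j e m, OF a e] L_def N_def by (simp add: mult_ac)
qed

text \<open>If p^f divides the lcm exactly, then p^f \<le> Y, so p^(2f) \<le> Y^2 \<le> 2^c \<le>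
  p^c. A power of \<open>a\<close> with logarithmic exponent thus replaces the squared lcm.\<close>

lemma p_integral_power_mult:
  assumes p: "prime p" "int p dvd a" and Y: "Y \<ge> 1" "Y ^ 2 \<le> 2 ^ c"
    and x: "p_integral p (of_nat (Lcm {1..Y}) ^ 2 * x)"
  shows "p_integral p (of_int a ^ c * x)"
proof -
  define L where "L = Lcm {1..Y}"
  define f where "f = multiplicity p L"
  have L0: "L \<noteq> 0" unfolding L_def by (auto simp: Lcm_0_iff)
  obtain w where w: "L = p ^ f * w" "\<not> p dvd w"
    using multiplicity_decompose'[of L p] L0 p(1) unfolding f_def by (metis not_prime_unit)
  have "p ^ f dvd L" using w by simp
  hence "p ^ f \<le> Y" using prime_power_dvd_Lcm_upto_iff[OF p(1), of f Y] Y(1) unfolding L_def by auto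
  hence "(p ^ f) ^ 2 \<le> 2 ^ c" using order_trans[OF power_mono[of "p ^ f" Y 2] Y(2)] by blast
  also have "\<dots> \<le> p ^ c" using prime_ge_2_nat[OF p(1)] by (rule power_mono) simp
  finally have "p ^ (f * 2) \<le> p ^ c" by (simp add: power_mult)
  hence fc: "f * 2 \<le> c" using prime_gt_1_nat[OF p(1)] by simp
  obtain b where b: "a = int p * b" using p(2) by (rule dvdE)
  have "of_nat (w ^ 2) * (of_int a ^ c * x) = of_int b ^ c * of_nat p ^ (c - f * 2) * (of_nat L ^ 2 * x)"
  proof -
    have "(of_nat p :: rat) ^ c = of_nat p ^ (c - f * 2) * (of_nat p ^ f) ^ 2"
      using fc by (simp add: power_mult[symmetric] power_add[symmetric])
    thus ?thesis unfolding b w(1) by (simp add: power_mult_distrib)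
  qed
  also have "p_integral p \<dots>"
    using p by (intro p_integral_mult[OF p(1) _ x[folded L_def]] p_integral_mult[OF p(1)] p_integral_power) auto
  finally show ?thesis
    using p_integral_cancel_nat[OF p(1), of "w ^ 2"] w(2) prime_dvd_power[OF p(1), of w 2] by blast
qed

section \<open>From p-adic convergence to integrality\<close>

lemma p_integral_power_prime_mult:
  assumes "prime p"
  shows "\<exists>e. p_integral p (of_nat p ^ e * x)"
proof -
  obtain n d where nd: "quotient_of x = (n, d)" by (cases "quotient_of x")
  have d: "d > 0" "x = of_int n / of_int d"
    using quotient_of_denom_pos[OF nd] quotient_of_div[OF nd] by auto
  define e where "e = multiplicity (int p) d"
  obtain w where w: "d = int p ^ e * w" "\<not> int p dvd w"
    using multiplicity_decompose'[of d "int p"] d(1) assms unfolding e_def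
    by (metis less_irrefl not_prime_unit prime_nat_int_transfer)
  have "of_nat p ^ e * x = of_int n / of_int w"
    using d assms prime_gt_0_nat[OF assms] unfolding w(1) by (auto simp: divide_simps mult_ac)
  moreover have "p_integral p (of_int n / of_int w)" using assms w(2) by (intro p_integral_divide_unit) auto
  ultimately show ?thesis by metis
qed

text \<open>The strict inequality puts e + 1 factors \<open>p\<close> into the numerator, so the
  reduced denominator is prime to \<open>p\<close>, even for e = 0.\<close>

lemma p_integral_if_padic_abs_small:
  assumes "prime p" "padic_abs p q < 1 / real p ^ e"
  shows "p_integral p (q / of_nat p ^ e)"
proof (cases "q = 0")
  case False
  obtain n d where nd: "quotient_of q = (n, d)" by (cases "quotient_of q")
  have d: "d > 0" "q = of_int n / of_int d" "coprime n d"
    using quotient_of_denom_pos[OF nd] quotient_of_div[OF nd] quotient_of_coprime[OF nd] by auto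
  have n0: "n \<noteq> 0" using False d by auto
  have p1: "real p > 1" using prime_gt_1_nat[OF assms(1)] by simp
  have "real p powr (- real_of_int (padic_val_rat p q)) < real p powr (- real e)"
    using assms(2) False p1 unfolding padic_abs_def by (simp add: powr_minus powr_realpow divide_inverse)
  hence "real e < real_of_int (padic_val_rat p q)" using p1 by simp
  hence mult: "multiplicity (int p) n > e" unfolding padic_val_rat_def nd by simp
  have "int p ^ Suc e dvd n" using mult by (intro multiplicity_dvd') simp
  then obtain w where w: "n = int p ^ Suc e * w" by (rule dvdE)
  hence "int p dvd n" by simp
  hence "\<not> int p dvd d" using d(3) assms(1)
    by (metis coprime_common_divisor not_prime_unit prime_nat_int_transfer)
  hence "p_integral p (of_int (int p * w) / of_int d)"
    using assms(1) by (intro p_integral_divide_unit p_integral_of_int)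
  moreover have "q / of_nat p ^ e = of_int (int p * w) / of_int d"
    unfolding d(2) w using p1 by (simp add: field_simps)
  ultimately show ?thesis by simp
qed (use assms in simp)

lemma lin_partial_shift:
  "lin_partial \<alpha> m l a (M + k) = lin_partial \<alpha> m l a k
     + (\<Sum>j=1..m. of_int (l j) * (\<Sum>i<M. phi_coeff \<alpha> j (k + i) * of_int a ^ (k + i)))"
proof -
  have "(\<Sum>i<M + k. f i) = (\<Sum>i<k. f i) + (\<Sum>i<M. f (k + i))" for f :: "nat \<Rightarrow> rat"
    by (induction M) (auto simp: add.commute)
  thus ?thesis unfolding lin_partial_def by (simp add: algebra_simps sum.distrib)
qed

text \<open>Replacing the \<open>k\<close>-th partial sum by the (M + k)-th adds terms of index k +
  i with i < M. Under the weight a^(N-k) they carry a^(N+i), and summation over \<open>k\<close>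
  gathers them into \<open>remainder_coeff\<close>. If the relation holds, the shifted sum tends to
  0 p-adically as \<open>M\<close> grows.\<close>

lemma approx_form_shift:
  fixes m n :: nat
  defines "N \<equiv> m * n + m"
  shows "approx_form \<alpha> m l a n e
    = (\<Sum>k\<le>N. approx_coeff \<alpha> m n e k * of_int a ^ (N - k) * lin_partial \<alpha> m l a (M + k))
      - of_int a ^ N * (\<Sum>j=1..m. of_int (l j) * (\<Sum>i<M. of_int a ^ i * remainder_coeff \<alpha> m n e j i))"
proof -
  define q where "q = approx_coeff \<alpha> m n e"
  define z :: rat where "z = of_int a"
  have "(\<Sum>k\<le>N. q k * z ^ (N - k) * (\<Sum>j=1..m. of_int (l j) * (\<Sum>i<M. phi_coeff \<alpha> j (k + i) * z ^ (k + i))))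
     = (\<Sum>k\<le>N. \<Sum>j=1..m. \<Sum>i<M. z ^ N * of_int (l j) * z ^ i * (q k * phi_coeff \<alpha> j (k + i)))"
  proof (intro sum.cong refl)
    fix k assume "k \<in> {..N}"
    hence "z ^ N = z ^ (N - k) * z ^ k" by (simp add: power_add[symmetric])
    thus "q k * z ^ (N - k) * (\<Sum>j=1..m. of_int (l j) * (\<Sum>i<M. phi_coeff \<alpha> j (k + i) * z ^ (k + i)))
       = (\<Sum>j=1..m. \<Sum>i<M. z ^ N * of_int (l j) * z ^ i * (q k * phi_coeff \<alpha> j (k + i)))"
      unfolding sum_distrib_left by (intro sum.cong refl) (simp add: power_add)
  qed
  also have "\<dots> = (\<Sum>j=1..m. \<Sum>k\<le>N. \<Sum>i<M. z ^ N * of_int (l j) * z ^ i * (q k * phi_coeff \<alpha> j (k + i)))"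
    by (rule sum.swap)
  also have "\<dots> = (\<Sum>j=1..m. \<Sum>i<M. \<Sum>k\<le>N. z ^ N * of_int (l j) * z ^ i * (q k * phi_coeff \<alpha> j (k + i)))"
    by (intro sum.cong refl sum.swap)
  also have "\<dots> = z ^ N * (\<Sum>j=1..m. of_int (l j) * (\<Sum>i<M. z ^ i * remainder_coeff \<alpha> m n e j i))"
    unfolding remainder_coeff_def sum_distrib_left q_def N_def by (simp add: mult_ac)
  finally show ?thesis
    unfolding approx_form_def lin_partial_shift N_def[symmetric] q_def z_def by (simp add: algebra_simps sum.distrib)
qed

text \<open>This is what carries the bound on the lcm from index \<open>n\<close> to index n + h at
  the price of \<open>h\<close> further factors of \<open>a\<close>.\<close>

lemma Suc_square_le: "(Suc h)\<^sup>2 \<le> 4 * 2 ^ h"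
proof (induction h rule: less_induct)
  case (less h)
  consider "h = 0" | "h = 1" | "h = 2" | g where "h = Suc (Suc (Suc g))"
    by (metis One_nat_def Suc_1 not0_implies_Suc)
  thus ?case
  proof cases
    case (4 g)
    have "(Suc h)\<^sup>2 \<le> 2 * (Suc (Suc (Suc g)))\<^sup>2" unfolding 4 by (simp add: power2_eq_square algebra_simps)
    also have "\<dots> \<le> 2 * (4 * 2 ^ Suc (Suc g))" using less[of "Suc (Suc g)"] 4 by simp
    finally show ?thesis using 4 by simp
  qed (auto simp: power2_eq_square)
qed

text \<open>In the shifted form the first sum is p-integral even after division by a^(N+n), once
  \<open>M\<close> is large. In the second sum the coefficients with i < n vanish, and for i \<ge> n
  the factor a^(N+i) supplies the power wanted, while a^B pays for the denominators.\<close>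

lemma approx_form_p_divisible:
  assumes pos: "\<And>j. j \<le> m \<Longrightarrow> \<alpha> j > 0" and e: "e \<le> m"
    and p: "prime p" "int p dvd a" "\<not> p dvd s_lcm \<alpha> m"
    and rel: "padic_relation \<alpha> m l a p" and a: "a \<noteq> 0"
    and Y: "\<And>j u i. 1 \<le> j \<Longrightarrow> j \<le> m \<Longrightarrow> \<alpha> j + \<alpha> 0 = of_nat u / of_nat (vden \<alpha> j) \<Longrightarrow> u + vden \<alpha> j * i \<le> U + V * i"
    and B: "U \<ge> 1" "4 * (U + V * (m * n + m + n)) ^ 2 \<le> 2 ^ B"
  shows "p_integral p (approx_form \<alpha> m l a n e * of_int a ^ B / of_int a ^ (m * n + m + n))"
proof -
  define N where "N = m * n + m"
  define z :: rat where "z = of_int a"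
  have z0: "z \<noteq> 0" using a unfolding z_def by simp
  have ev: "eventually (\<lambda>M. p_integral p (t * lin_partial \<alpha> m l a (M + k))) sequentially" for t k
  proof -
    obtain f where f: "p_integral p (of_nat p ^ f * t)" using p_integral_power_prime_mult[OF p(1)] by blast
    have p0: "p > 0" using prime_gt_0_nat[OF p(1)] .
    have "eventually (\<lambda>K. padic_abs p (lin_partial \<alpha> m l a K) < 1 / real p ^ f) sequentially"
      using rel p0 unfolding padic_relation_def by (intro order_tendstoD(2)) auto
    hence "eventually (\<lambda>K. p_integral p (t * lin_partial \<alpha> m l a K)) sequentially"
    proof eventually_elim
      case (elim K)
      have "p_integral p ((of_nat p ^ f * t) * (lin_partial \<alpha> m l a K / of_nat p ^ f))"
        by (rule p_integral_mult[OF p(1) f p_integral_if_padic_abs_small[OF p(1) elim]])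
      thus ?case using p0 by simp
    qed
    thus ?thesis by (rule sequentially_offset)
  qed
  \<comment> \<open>These weights do not depend on \<open>M\<close> and are finitely many, so a
    single \<open>M\<close> serves all of them.\<close>
  define t where "t = (\<lambda>k. approx_coeff \<alpha> m n e k * z ^ (N - k) * z ^ B / z ^ (N + n))"
  have "eventually (\<lambda>M. \<forall>k\<in>{..N}. p_integral p (t k * lin_partial \<alpha> m l a (M + k))) sequentially"
    using ev by (intro eventually_ball_finite) auto
  then obtain M where M: "\<And>k. k \<le> N \<Longrightarrow> p_integral p (t k * lin_partial \<alpha> m l a (M + k))"
    by (auto simp: eventually_sequentially)
  have rem: "p_integral p (z ^ B * z ^ i * remainder_coeff \<alpha> m n e j i / z ^ n)" if j: "1 \<le> j" "j \<le> m" for i j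
  proof (cases "i < n")
    case True
    hence "remainder_coeff \<alpha> m n e j i = 0" using pos e j by (intro remainder_coeff_eq_0) auto
    thus ?thesis using p by simp
  next
    case False
    \<comment> \<open>Here \<open>h\<close> counts the factors of \<open>a\<close> beyond a^n. From
      Z \<le> X (h + 1) one gets Z^2 \<le> 2^(B+h), so a^(B+h) clears the squared lcm with the same
      \<open>B\<close> for all \<open>i\<close>.\<close>
    define h where "h = i - n"
    have i: "i = n + h" using False h_def by simp
    define X where "X = U + V * (N + n)"
    define Z where "Z = U + V * (N + i)"
    have "Z \<le> X * Suc h"
    proof -
      have "V * h \<le> X * h"
      proof (cases "N + n = 0")
        case True
        hence "m = 0" unfolding N_def by simp
        thus ?thesis using j by simp
      next
        case False
        hence "V * 1 \<le> V * (N + n)" by (intro mult_left_mono) auto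
        hence "V \<le> X" unfolding X_def by linarith
        thus ?thesis by simp
      qed
      thus ?thesis unfolding Z_def X_def i by (simp add: algebra_simps)
    qed
    hence "Z ^ 2 \<le> (X * Suc h) ^ 2" by (rule power_mono) simp
    also have "\<dots> = X ^ 2 * (Suc h) ^ 2" by (rule power_mult_distrib)
    also have "\<dots> \<le> X ^ 2 * (4 * 2 ^ h)" by (intro mult_left_mono Suc_square_le) simp
    also have "\<dots> \<le> 2 ^ B * 2 ^ h" using B(2) unfolding X_def N_def by simp
    also have "\<dots> = 2 ^ (B + h)" by (simp add: power_add)
    finally have Z: "Z ^ 2 \<le> 2 ^ (B + h)" .
    have "p_integral p (of_nat (Lcm {1..Z}) ^ 2 * remainder_coeff \<alpha> m n e j i)"
      using pos j e p Y unfolding Z_def N_def by (intro p_integral_remainder_coeff) auto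
    hence "p_integral p (of_int a ^ (B + h) * remainder_coeff \<alpha> m n e j i)"
      using p Z B(1) by (intro p_integral_power_mult) (auto simp: Z_def)
    thus ?thesis unfolding i z_def[symmetric] using z0 by (simp add: power_add mult_ac)
  qed
  have "approx_form \<alpha> m l a n e * z ^ B / z ^ (N + n)
     = (\<Sum>k\<le>N. t k * lin_partial \<alpha> m l a (M + k))
       - (\<Sum>j=1..m. of_int (l j) * (\<Sum>i<M. z ^ B * z ^ i * remainder_coeff \<alpha> m n e j i / z ^ n))"
  proof -
    have "(\<Sum>k\<le>N. approx_coeff \<alpha> m n e k * z ^ (N - k) * lin_partial \<alpha> m l a (M + k)) * z ^ B / z ^ (N + n)
       = (\<Sum>k\<le>N. t k * lin_partial \<alpha> m l a (M + k))"
      unfolding t_def sum_distrib_right sum_divide_distrib by (simp add: mult_ac)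
    moreover have "z ^ N * S * z ^ B / z ^ (N + n) = S * z ^ B / z ^ n" for S
      using z0 by (simp add: power_add)
    moreover have "(\<Sum>j=1..m. of_int (l j) * (\<Sum>i<M. z ^ i * remainder_coeff \<alpha> m n e j i)) * z ^ B / z ^ n
       = (\<Sum>j=1..m. of_int (l j) * (\<Sum>i<M. z ^ B * z ^ i * remainder_coeff \<alpha> m n e j i / z ^ n))"
      unfolding sum_distrib_right sum_distrib_left sum_divide_distrib by (simp add: mult_ac)
    ultimately show ?thesis
      unfolding approx_form_shift[of \<alpha> m l a n e M] N_def[symmetric] z_def[symmetric] left_diff_distrib diff_divide_distrib by simp
  qed
  also have "p_integral p \<dots>"
    using p(1) M rem by (intro p_integral_diff p_integral_sum p_integral_mult[OF _ p_integral_of_int]) auto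
  finally show ?thesis unfolding N_def z_def .
qed

subsection \<open>Archimedean size\<close>

lemma abs_pochhammer_mono:
  fixes x y :: rat
  assumes "\<And>t. t < k \<Longrightarrow> \<bar>x + of_nat t\<bar> \<le> \<bar>y + of_nat t\<bar>"
  shows "\<bar>pochhammer x k\<bar> \<le> \<bar>pochhammer y k\<bar>"
  unfolding pochhammer_prod abs_prod using assms by (intro prod_mono) auto

text \<open>The quotient is the binomial coefficient C(c + k - 1, k).\<close>

lemma pochhammer_of_nat_div_fact_le:
  assumes "c \<ge> 1"
  shows "pochhammer (of_nat c) k / fact k \<le> (2 :: rat) ^ (c + k)"
proof -
  have "pochhammer (of_nat c) k / fact k = (of_nat (c + k - 1) :: rat) gchoose k"
    unfolding gbinomial_pochhammer' using assms by (simp add: of_nat_diff)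
  also have "\<dots> = of_nat (c + k - 1 choose k)" by (simp only: binomial_gbinomial)
  also have "c + k - 1 choose k \<le> 2 ^ (c + k - 1)" by (rule binomial_le_pow2)
  hence "of_nat (c + k - 1 choose k) \<le> (of_nat (2 ^ (c + k - 1)) :: rat)" by (rule of_nat_mono)
  also have "\<dots> \<le> 2 ^ (c + k)" by simp
  finally show ?thesis .
qed

text \<open>Factor by factor, the Pochhammer symbols are dominated by those at \<open>c\<close>, at
  -(c + N - 1) and at c + i, whose quotients by factorials are binomial coefficients up to sign. The
  polynomial factor comes from the number of summands and from i^e.\<close>

lemma approx_coeff_bound:
  fixes \<alpha> :: "nat \<Rightarrow> rat" and m n :: nat
  assumes pos: "\<And>j. j \<le> m \<Longrightarrow> \<alpha> j > 0" and c: "c \<ge> 1" "\<And>j. j \<le> m \<Longrightarrow> \<alpha> j \<le> of_nat c"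
    and e: "e \<le> m"
  defines "N \<equiv> m * n + m"
  assumes k: "k \<le> N"
  shows "\<bar>approx_coeff \<alpha> m n e k\<bar> \<le> of_nat (N + 1) ^ (m + 1) * 2 ^ (2 * (c + N) + m * (c + N + n))"
proof -
  have a0: "0 < \<alpha> 0" "\<alpha> 0 \<le> of_nat c" using pos c by auto
  have c1: "(1::rat) \<le> of_nat c" using c(1) by simp
  have t1: "\<bar>pochhammer (\<alpha> 0 - 1) q / fact q\<bar> \<le> 2 ^ (c + N)" if "q \<le> N" for q
  proof -
    have "\<bar>pochhammer (\<alpha> 0 - 1) q\<bar> \<le> \<bar>pochhammer (of_nat c) q\<bar>"
    proof (rule abs_pochhammer_mono)
      fix t show "\<bar>\<alpha> 0 - 1 + of_nat t\<bar> \<le> \<bar>of_nat c + of_nat t\<bar>"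
        using a0 c1 of_nat_0_le_iff[of t, where ?'a = rat] by linarith
    qed
    also have "\<dots> = pochhammer (of_nat c) q" using pochhammer_nonneg[of "of_nat c :: rat" q] c1 by simp
    finally have "\<bar>pochhammer (\<alpha> 0 - 1) q / fact q\<bar> \<le> pochhammer (of_nat c) q / fact q"
      by (simp add: divide_right_mono)
    also have "\<dots> \<le> 2 ^ (c + q)" by (rule pochhammer_of_nat_div_fact_le[OF c(1)])
    also have "\<dots> \<le> 2 ^ (c + N)" using that by (intro power_increasing) auto
    finally show ?thesis .
  qed
  have t2: "\<bar>pochhammer (1 - \<alpha> 0 - of_nat N) i / fact i\<bar> \<le> 2 ^ (c + N)" if "i \<le> N" for i
  proof -
    have "\<bar>pochhammer (1 - \<alpha> 0 - of_nat N) i\<bar> \<le> \<bar>pochhammer (- of_nat (c + N - 1)) i\<bar>"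
    proof (rule abs_pochhammer_mono)
      fix t assume "t < i"
      hence "of_nat (Suc t) \<le> (of_nat N :: rat)" using that by (intro of_nat_mono) simp
      thus "\<bar>1 - \<alpha> 0 - of_nat N + of_nat t\<bar> \<le> \<bar>- of_nat (c + N - 1) + of_nat t :: rat\<bar>"
        using a0 c1 c(1) by (simp add: of_nat_diff)
    qed
    also have "\<dots> / fact i = \<bar>(of_nat (c + N - 1) :: rat) gchoose i\<bar>"
      unfolding gbinomial_pochhammer by (simp add: abs_mult)
    also have "\<dots> = of_nat (c + N - 1 choose i)" by (simp only: binomial_gbinomial[symmetric] abs_of_nat)
    also have "(of_nat (c + N - 1 choose i) :: rat) \<le> of_nat (2 ^ (c + N - 1))" by (intro of_nat_mono binomial_le_pow2)
    also have "\<dots> \<le> 2 ^ (c + N)" by simp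
    finally show ?thesis by (simp add: divide_right_mono)
  qed
  have t3: "\<bar>aux_poly \<alpha> m n e (- of_nat i)\<bar> \<le> 2 ^ (m * (c + N + n)) * of_nat (N + 1) ^ m" if "i \<le> N" for i
  proof -
    have "\<bar>pochhammer (\<alpha> j + of_nat i) n / fact n\<bar> \<le> 2 ^ (c + N + n)" if j: "j \<in> {1..m}" for j
    proof -
      have "0 < \<alpha> j" "\<alpha> j \<le> of_nat c" using pos c j by auto
      hence "\<bar>pochhammer (\<alpha> j + of_nat i) n\<bar> \<le> \<bar>pochhammer (of_nat (c + i)) n\<bar>"
        by (intro abs_pochhammer_mono) auto
      also have "\<dots> = pochhammer (of_nat (c + i)) n" using pochhammer_nonneg[of "of_nat (c + i) :: rat" n] c(1) by simp
      finally have "\<bar>pochhammer (\<alpha> j + of_nat i) n / fact n\<bar> \<le> pochhammer (of_nat (c + i)) n / fact n"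
        by (simp add: divide_right_mono)
      also have "\<dots> \<le> 2 ^ (c + i + n)" using c(1) by (intro pochhammer_of_nat_div_fact_le) simp
      also have "\<dots> \<le> 2 ^ (c + N + n)" using \<open>i \<le> N\<close> by (intro power_increasing) auto
      finally show ?thesis .
    qed
    hence "(\<Prod>j=1..m. \<bar>pochhammer (\<alpha> j + of_nat i) n / fact n\<bar>) \<le> (\<Prod>j=1..m. 2 ^ (c + N + n))"
      by (intro prod_mono) auto
    also have "\<dots> = 2 ^ (m * (c + N + n))" by (simp add: power_mult[symmetric] mult.commute)
    finally have "(\<Prod>j=1..m. \<bar>pochhammer (\<alpha> j + of_nat i) n / fact n\<bar>) \<le> 2 ^ (m * (c + N + n))" .
    moreover have "(of_nat i :: rat) ^ e \<le> of_nat (N + 1) ^ m"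
    proof -
      have "(of_nat i :: rat) ^ e \<le> of_nat (N + 1) ^ e" using that by (intro power_mono) auto
      also have "\<dots> \<le> of_nat (N + 1) ^ m" using e by (intro power_increasing) auto
      finally show ?thesis .
    qed
    ultimately have "(\<Prod>j=1..m. \<bar>pochhammer (\<alpha> j + of_nat i) n / fact n\<bar>) * of_nat i ^ e \<le> 2 ^ (m * (c + N + n)) * of_nat (N + 1) ^ m"
      by (intro mult_mono) auto
    thus ?thesis unfolding aux_poly_def by (simp add: abs_mult abs_prod power_abs)
  qed
  have "\<bar>approx_coeff \<alpha> m n e k\<bar> \<le> (\<Sum>i\<le>k. \<bar>pochhammer (\<alpha> 0 - 1) (k - i) / fact (k - i)
       * (pochhammer (1 - \<alpha> 0 - of_nat N) i / fact i) * aux_poly \<alpha> m n e (- of_nat i)\<bar>)"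
    unfolding approx_coeff_def inv_coeff_def N_def by (rule sum_abs)
  also have "\<dots> \<le> (\<Sum>i\<le>k. 2 ^ (c + N) * 2 ^ (c + N) * (2 ^ (m * (c + N + n)) * of_nat (N + 1) ^ m))"
    unfolding abs_mult using k by (intro sum_mono mult_mono t1 t2 t3) auto
  also have "\<dots> = of_nat (k + 1) * (2 ^ (c + N) * 2 ^ (c + N) * (2 ^ (m * (c + N + n)) * of_nat (N + 1) ^ m))" by simp
  also have "\<dots> \<le> of_nat (N + 1) * (2 ^ (c + N) * 2 ^ (c + N) * (2 ^ (m * (c + N + n)) * of_nat (N + 1) ^ m))"
    using k by (intro mult_right_mono) auto
  also have "\<dots> = of_nat (N + 1) ^ (m + 1) * 2 ^ (2 * (c + N) + m * (c + N + n))"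
    by (simp add: power_add mult_2)
  finally show ?thesis .
qed

lemma phi_coeff_le_1:
  assumes "\<alpha> 0 > 0" "\<alpha> j > 0"
  shows "phi_coeff \<alpha> j i \<le> 1"
proof -
  have "\<bar>pochhammer (\<alpha> j) i\<bar> \<le> \<bar>pochhammer (\<alpha> j + \<alpha> 0) i\<bar>"
    using assms by (intro abs_pochhammer_mono) auto
  thus ?thesis unfolding phi_coeff_def using pochhammer_pos[of "\<alpha> j" i] pochhammer_pos[of "\<alpha> j + \<alpha> 0" i] assms
    by (simp add: divide_le_eq_1_pos)
qed

text \<open>The coefficients of the series lie between 0 and 1 and |a| \<ge> 1, so each of the
  \<open>k\<close> terms of a partial sum is at most |a|^k.\<close>

lemma lin_partial_bound:
  assumes pos: "\<And>j. j \<le> m \<Longrightarrow> \<alpha> j > 0" and a: "\<bar>a\<bar> \<ge> 1" and k: "k \<le> N"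
  shows "\<bar>lin_partial \<alpha> m l a k\<bar> \<le> (\<Sum>j\<le>m. \<bar>of_int (l j)\<bar>) * of_nat (N + 1) * of_int \<bar>a\<bar> ^ k"
proof -
  define C :: rat where "C = of_nat (N + 1) * of_int \<bar>a\<bar> ^ k"
  have a1: "(1 :: rat) \<le> of_int \<bar>a\<bar>" using a by (metis of_int_1 of_int_le_iff)
  have inner: "\<bar>\<Sum>i<k. phi_coeff \<alpha> j i * of_int a ^ i\<bar> \<le> C" if j: "j \<in> {1..m}" for j
  proof -
    have aj: "\<alpha> 0 > 0" "\<alpha> j > 0" using pos j by auto
    have "\<bar>\<Sum>i<k. phi_coeff \<alpha> j i * of_int a ^ i\<bar> \<le> (\<Sum>i<k. \<bar>phi_coeff \<alpha> j i * of_int a ^ i\<bar>)" by (rule sum_abs)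
    also have "\<dots> \<le> (\<Sum>i<k. of_int \<bar>a\<bar> ^ k)"
    proof (rule sum_mono)
      fix i assume "i \<in> {..<k}"
      hence "of_int \<bar>a\<bar> ^ i \<le> (of_int \<bar>a\<bar> ^ k :: rat)" using a1 by (intro power_increasing) auto
      moreover have "\<bar>phi_coeff \<alpha> j i\<bar> \<le> 1" using phi_coeff_le_1[of \<alpha> j i, OF aj] phi_coeff_pos[of \<alpha> j i, OF aj] by simp
      ultimately have "\<bar>phi_coeff \<alpha> j i\<bar> * of_int \<bar>a\<bar> ^ i \<le> 1 * of_int \<bar>a\<bar> ^ k" by (intro mult_mono) auto
      thus "\<bar>phi_coeff \<alpha> j i * of_int a ^ i\<bar> \<le> of_int \<bar>a\<bar> ^ k" by (simp add: abs_mult power_abs)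
    qed
    also have "\<dots> = of_nat k * of_int \<bar>a\<bar> ^ k" by simp
    also have "\<dots> \<le> C" unfolding C_def using k by (intro mult_right_mono) auto
    finally show ?thesis .
  qed
  have C1: "1 \<le> C" unfolding C_def using a1 mult_mono[of 1 "of_nat (N + 1)" 1 "of_int \<bar>a\<bar> ^ k :: rat"] by (simp add: one_le_power)
  have "\<bar>lin_partial \<alpha> m l a k\<bar> \<le> \<bar>of_int (l 0)\<bar> + (\<Sum>j=1..m. \<bar>of_int (l j) * (\<Sum>i<k. phi_coeff \<alpha> j i * of_int a ^ i)\<bar>)"
    unfolding lin_partial_def by (rule order_trans[OF abs_triangle_ineq]) (intro add_left_mono sum_abs)
  also have "\<dots> \<le> \<bar>of_int (l 0)\<bar> * C + (\<Sum>j=1..m. \<bar>of_int (l j)\<bar> * C)"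
    unfolding abs_mult using C1 inner mult_left_mono[OF C1, of "\<bar>of_int (l 0)\<bar>"]
    by (intro add_mono sum_mono mult_left_mono) auto
  also have "\<dots> = (\<Sum>j\<le>m. \<bar>of_int (l j)\<bar>) * C"
    by (simp add: atMost_atLeast0 sum.atLeast_Suc_atMost sum_distrib_right distrib_right)
  finally show ?thesis unfolding C_def by (simp add: mult.assoc)
qed

lemma approx_form_bound:
  fixes \<alpha> :: "nat \<Rightarrow> rat" and m n :: nat
  assumes pos: "\<And>j. j \<le> m \<Longrightarrow> \<alpha> j > 0" and c: "c \<ge> 1" "\<And>j. j \<le> m \<Longrightarrow> \<alpha> j \<le> of_nat c"
    and e: "e \<le> m" and a: "\<bar>a\<bar> \<ge> 1"
  defines "N \<equiv> m * n + m"
  shows "\<bar>approx_form \<alpha> m l a n e\<bar> \<le> of_nat (N + 1) ^ (m + 3) * 2 ^ (2 * (c + N) + m * (c + N + n))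
      * (\<Sum>j\<le>m. \<bar>of_int (l j)\<bar>) * of_int \<bar>a\<bar> ^ N"
proof -
  define F :: rat where "F = of_nat (N + 1) ^ (m + 1) * 2 ^ (2 * (c + N) + m * (c + N + n))"
  define \<Lambda> :: rat where "\<Lambda> = (\<Sum>j\<le>m. \<bar>of_int (l j)\<bar>)"
  have "\<bar>approx_form \<alpha> m l a n e\<bar> \<le> (\<Sum>k\<le>N. \<bar>approx_coeff \<alpha> m n e k * of_int a ^ (N - k) * lin_partial \<alpha> m l a k\<bar>)"
    unfolding approx_form_def N_def by (rule sum_abs)
  also have "\<dots> \<le> (\<Sum>k\<le>N. F * of_int \<bar>a\<bar> ^ (N - k) * (\<Lambda> * of_nat (N + 1) * of_int \<bar>a\<bar> ^ k))"
  proof (rule sum_mono)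
    fix k assume "k \<in> {..N}"
    hence k: "k \<le> N" by simp
    have "\<bar>approx_coeff \<alpha> m n e k\<bar> \<le> F"
      using approx_coeff_bound[of m \<alpha> c e k n] pos c e k unfolding F_def N_def by blast
    moreover have "\<bar>lin_partial \<alpha> m l a k\<bar> \<le> \<Lambda> * of_nat (N + 1) * of_int \<bar>a\<bar> ^ k"
      unfolding \<Lambda>_def using pos a k by (rule lin_partial_bound)
    moreover have "0 \<le> F" unfolding F_def by simp
    ultimately show "\<bar>approx_coeff \<alpha> m n e k * of_int a ^ (N - k) * lin_partial \<alpha> m l a k\<bar>
        \<le> F * of_int \<bar>a\<bar> ^ (N - k) * (\<Lambda> * of_nat (N + 1) * of_int \<bar>a\<bar> ^ k)"
      unfolding abs_mult by (intro mult_mono) (auto simp: power_abs)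
  qed
  also have "\<dots> = (\<Sum>k\<le>N. F * \<Lambda> * of_nat (N + 1) * of_int \<bar>a\<bar> ^ N)"
  proof (intro sum.cong refl)
    fix k assume "k \<in> {..N}"
    hence "(of_int \<bar>a\<bar> :: rat) ^ N = of_int \<bar>a\<bar> ^ (N - k) * of_int \<bar>a\<bar> ^ k" by (simp add: power_add[symmetric])
    thus "F * of_int \<bar>a\<bar> ^ (N - k) * (\<Lambda> * of_nat (N + 1) * of_int \<bar>a\<bar> ^ k) = F * \<Lambda> * of_nat (N + 1) * of_int \<bar>a\<bar> ^ N"
      by (simp only: mult_ac)
  qed
  also have "\<dots> = of_nat (N + 1) * (F * \<Lambda> * of_nat (N + 1) * of_int \<bar>a\<bar> ^ N)" by simp
  also have "\<dots> = of_nat (N + 1) ^ (m + 3) * 2 ^ (2 * (c + N) + m * (c + N + n)) * \<Lambda> * of_int \<bar>a\<bar> ^ N"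
  proof -
    have "of_nat (N + 1) ^ (m + 3) = (of_nat (N + 1) * of_nat (N + 1) * of_nat (N + 1) ^ (m + 1) :: rat)"
      by (simp only: power_add power_Suc numeral_3_eq_3) simp
    thus ?thesis unfolding F_def by (simp only: mult_ac)
  qed
  finally show ?thesis unfolding \<Lambda>_def .
qed

text \<open>If x > T, put L = ln (x/T) > 0. The assumption keeps (L (n+1))^G / exp (L (n+1)) above a
  positive constant, yet it tends to 0.\<close>

lemma exponential_vs_polynomial:
  fixes x T K :: real
  assumes "T > 0" "\<And>n. x ^ n \<le> K * (real n + 1) ^ G * T ^ n"
  shows "x \<le> T"
proof (rule ccontr)
  assume "\<not> x \<le> T"
  define L where "L = ln (x / T)"
  have L: "L > 0" unfolding L_def using \<open>\<not> x \<le> T\<close> assms(1) by (simp add: ln_gt_zero_iff)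
  have eL: "exp L = x / T" unfolding L_def using \<open>\<not> x \<le> T\<close> assms(1) by simp
  have K: "K \<ge> 1" using assms(2)[of 0] by simp
  have low: "L ^ G / (K * exp L) \<le> (L * (real n + 1)) ^ G / exp (L * (real n + 1))" for n
  proof -
    have "exp L ^ n \<le> K * (real n + 1) ^ G"
      unfolding eL power_divide using assms(2)[of n] assms(1) by (simp add: divide_le_eq)
    hence "exp L * exp L ^ n \<le> exp L * (K * (real n + 1) ^ G)" by simp
    hence "exp (L * (real n + 1)) \<le> exp L * K * (real n + 1) ^ G"
      by (simp add: exp_of_nat_mult[symmetric] exp_add[symmetric] algebra_simps)
    hence "L ^ G * exp (L * (real n + 1)) \<le> L ^ G * (exp L * K * (real n + 1) ^ G)"
      using L by (intro mult_left_mono) auto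
    moreover define q where "q = real n + 1"
    ultimately show ?thesis using K L unfolding q_def[symmetric] by (simp add: field_simps power_mult_distrib)
  qed
  have "filterlim (\<lambda>n. L * (real n + 1)) at_top sequentially"
    using L filterlim_tendsto_pos_mult_at_top[OF tendsto_const L, of "\<lambda>n. real n + 1" sequentially]
      filterlim_tendsto_add_at_top[OF tendsto_const filterlim_real_sequentially, of 1] by (simp add: add.commute)
  hence "((\<lambda>n. (L * (real n + 1)) ^ G / exp (L * (real n + 1))) \<longlongrightarrow> 0) sequentially"
    by (rule filterlim_compose[OF tendsto_power_div_exp_0])
  hence "L ^ G / (K * exp L) \<le> 0" by (rule LIMSEQ_le_const) (use low in auto)
  moreover have "L ^ G / (K * exp L) > 0" using L K by simp
  ultimately show False by simp
qed

subsection \<open>Comparison of the estimates\<close>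

text \<open>The number \<open>w\<close> is p-integral at the primes dividing \<open>a\<close> by the
  divisibility of the form, and at all others by its common denominator. So it is a nonzero integer
  and |w| \<ge> 1.\<close>

lemma approx_form_lower_bound:
  fixes \<alpha> :: "nat \<Rightarrow> rat" and m n :: nat
  assumes pos: "\<And>j. j \<le> m \<Longrightarrow> \<alpha> j > 0" and e: "e \<le> m" and a: "a \<noteq> 0"
    and cop: "coprime a (int (s_lcm \<alpha> m))"
    and rel: "\<And>p. prime p \<Longrightarrow> int p dvd a \<Longrightarrow> padic_relation \<alpha> m l a p"
    and Y: "\<And>j u i. 1 \<le> j \<Longrightarrow> j \<le> m \<Longrightarrow> \<alpha> j + \<alpha> 0 = of_nat u / of_nat (vden \<alpha> j) \<Longrightarrow> u + vden \<alpha> j * i \<le> U + V * i"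
    and B: "U \<ge> 1" "4 * (U + V * (m * n + m + n)) ^ 2 \<le> 2 ^ B"
    and nz: "approx_form \<alpha> m l a n e \<noteq> 0"
  defines "N \<equiv> m * n + m"
  defines "D \<equiv> approx_denom \<alpha> m n * phi_denom \<alpha> m N (U + V * N)"
  assumes D: "D > 0"
  shows "of_int \<bar>a\<bar> ^ (N + n) \<le> of_nat D * \<bar>approx_form \<alpha> m l a n e\<bar> * of_int \<bar>a\<bar> ^ B"
proof -
  define w where "w = of_nat D * approx_form \<alpha> m l a n e * of_int a ^ B / of_int a ^ (N + n)"
  have "w \<in> \<int>"
  proof (rule Ints_if_p_integral)
    fix p :: nat assume p: "prime p"
    show "p_integral p w"
    proof (cases "int p dvd a")
      case True
      have "\<not> p dvd s_lcm \<alpha> m"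
        using cop True p by (metis coprime_common_divisor int_dvd_int_iff not_prime_unit prime_nat_int_transfer)
      hence "p_integral p (approx_form \<alpha> m l a n e * of_int a ^ B / of_int a ^ (N + n))"
        unfolding N_def using pos e p True rel a Y B by (intro approx_form_p_divisible[where U = U and V = V]) auto
      hence "p_integral p (of_nat D * (approx_form \<alpha> m l a n e * of_int a ^ B / of_int a ^ (N + n)))"
        using p by (intro p_integral_mult) auto
      thus ?thesis unfolding w_def by (simp add: mult_ac)
    next
      case False
      have "of_nat D * approx_form \<alpha> m l a n e \<in> \<int>"
        unfolding D_def N_def using pos Y by (intro approx_form_denominator) auto
      hence "of_nat D * approx_form \<alpha> m l a n e * of_int (a ^ B) \<in> \<int>" by (rule Ints_mult) simp
      moreover have "\<not> int p dvd a ^ (N + n)" using False p by (metis prime_dvd_power prime_nat_int_transfer)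
      ultimately have "p_integral p (of_nat D * approx_form \<alpha> m l a n e * of_int (a ^ B) / of_int (a ^ (N + n)))"
        using p by (intro p_integral_divide_unit p_integral_Ints)
      thus ?thesis unfolding w_def by simp
    qed
  qed
  moreover have "w \<noteq> 0" unfolding w_def using D nz a by simp
  ultimately have "1 \<le> \<bar>w\<bar>" by (metis Ints_nonzero_abs_ge1)
  also have "\<bar>w\<bar> = of_nat D * \<bar>approx_form \<alpha> m l a n e\<bar> * of_int \<bar>a\<bar> ^ B / of_int \<bar>a\<bar> ^ (N + n)"
    unfolding w_def by (simp add: abs_mult power_abs)
  finally show ?thesis using a by (simp add: le_divide_eq)
qed

section \<open>Growth of the estimates with \<open>n\<close>\<close>

lemma approx_denom_le:
  assumes "N = m * n + m"
  shows "real (approx_denom \<alpha> m n) \<le> (real (sden \<alpha> 0) * eps (sden \<alpha> 0)) ^ N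
     * ((\<Prod>j=1..m. real (sden \<alpha> j)) ^ n * (eps (s_lcm \<alpha> m) ^ n) ^ m)"
proof -
  have "real (approx_denom \<alpha> m n) = real (sden \<alpha> 0) ^ N * real (fact_part (sden \<alpha> 0) N)
     * ((\<Prod>j=1..m. real (sden \<alpha> j)) ^ n * real (fact_part (s_lcm \<alpha> m) n) ^ m)"
    unfolding approx_denom_def assms by (simp add: prod_power_distrib)
  also have "\<dots> \<le> real (sden \<alpha> 0) ^ N * eps (sden \<alpha> 0) ^ N
     * ((\<Prod>j=1..m. real (sden \<alpha> j)) ^ n * (eps (s_lcm \<alpha> m) ^ n) ^ m)"
    using eps_ge_1[of "sden \<alpha> 0"]
    by (intro mult_mono power_mono fact_part_le_eps_power) (auto intro!: mult_nonneg_nonneg zero_le_power prod_nonneg)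
  finally show ?thesis by (simp add: power_mult_distrib)
qed

lemma phi_denom_le:
  "real (phi_denom \<alpha> m N X) \<le> (real (d_tilde \<alpha> m) * eps (s_lcm \<alpha> m)) ^ N * 4 ^ X"
proof -
  have "real (Lcm {1..X}) \<le> real (4 ^ X)" using Lcm_upto_le[of X] by (rule of_nat_mono)
  hence "real (d_tilde \<alpha> m) ^ N * real (fact_part (s_lcm \<alpha> m) N) * real (Lcm {1..X})
      \<le> real (d_tilde \<alpha> m) ^ N * eps (s_lcm \<alpha> m) ^ N * 4 ^ X"
    using eps_ge_1[of "s_lcm \<alpha> m"] by (intro mult_mono fact_part_le_eps_power) auto
  thus ?thesis unfolding phi_denom_def by (simp add: power_mult_distrib)
qed

text \<open>Upper and lower bound of one nonzero form are combined; cancelling |a|^N leaves |a|^n.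
  The last factor bounds |a|^B and is polynomial in \<open>n\<close>.\<close>

lemma global_relation_growth:
  fixes \<alpha> :: "nat \<Rightarrow> rat" and m n :: nat and a :: int
  assumes m: "m \<ge> 1"
    and pos: "\<And>j. j \<le> m \<Longrightarrow> \<alpha> j > 0"
    and dist: "\<And>i j. 1 \<le> i \<Longrightarrow> i < j \<Longrightarrow> j \<le> m \<Longrightarrow> \<alpha> i - \<alpha> j \<notin> \<int>"
    and a: "\<bar>a\<bar> > 1" and cop: "coprime a (int (s_lcm \<alpha> m))"
    and l: "\<exists>j\<le>m. l j \<noteq> 0"
    and rel: "\<And>p. prime p \<Longrightarrow> int p dvd a \<Longrightarrow> padic_relation \<alpha> m l a p"
    and c: "c \<ge> 1" "\<And>j. j \<le> m \<Longrightarrow> \<alpha> j \<le> of_nat c"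
    and Y: "\<And>j u i. 1 \<le> j \<Longrightarrow> j \<le> m \<Longrightarrow> \<alpha> j + \<alpha> 0 = of_nat u / of_nat (vden \<alpha> j) \<Longrightarrow> u + vden \<alpha> j * i \<le> U + V * i"
    and U: "U \<ge> 1" and g: "\<bar>a\<bar> \<le> 2 ^ g"
  defines "N \<equiv> m * n + m"
  shows "real_of_int \<bar>a\<bar> ^ n \<le> real (approx_denom \<alpha> m n) * real (phi_denom \<alpha> m N (U + V * N))
      * (real (N + 1) ^ (m + 3) * 2 ^ (2 * (c + N) + m * (c + N + n)) * (\<Sum>j\<le>m. \<bar>real_of_int (l j)\<bar>))
      * (8 * real (U + V * (N + n)) ^ 2) ^ g"
proof -
  define X where "X = U + V * (N + n)"
  define D where "D = approx_denom \<alpha> m n * phi_denom \<alpha> m N (U + V * N)"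
  \<comment> \<open>The exponent \<open>B\<close> is chosen so that 2^B lies between 4 X^2, as
    divisibility demands, and 8 X^2, so that |a|^B \<le> (2^B)^g stays polynomial in
    \<open>n\<close>.\<close>
  have "4 * X ^ 2 \<ge> 1" using U unfolding X_def by (simp add: Suc_leI)
  then obtain b where b: "2 ^ b \<le> 4 * X ^ 2" "4 * X ^ 2 < 2 ^ (b + 1)"
    using ex_power_ivl1[of 2 "4 * X ^ 2"] by auto
  define B where "B = b + 1"
  have B: "4 * X ^ 2 \<le> 2 ^ B" "2 ^ B \<le> 8 * X ^ 2" using b unfolding B_def by auto
  have "sden \<alpha> j > 0" if "j \<le> m" for j using sden_fraction[of \<alpha> j] pos[OF that] by metis
  hence D0: "D > 0"
    using d_tilde_pos[of m \<alpha>] pos fact_part_pos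
    unfolding D_def approx_denom_def phi_denom_def by (auto simp: Lcm_0_iff intro!: prod_pos gr0I)
  have "a \<noteq> 0" using a by auto
  then obtain e where e: "e \<le> m" "approx_form \<alpha> m l a n e \<noteq> 0"
    using approx_form_nonzero[of m \<alpha> a l n, OF m pos dist _ l] by blast
  have a1: "(1::rat) \<le> of_int \<bar>a\<bar>" using a by (metis less_imp_le of_int_1 of_int_le_iff)
  have "of_int \<bar>a\<bar> ^ (N + n) \<le> of_nat D * \<bar>approx_form \<alpha> m l a n e\<bar> * (of_int \<bar>a\<bar> :: rat) ^ B"
    unfolding N_def D_def using pos e a cop rel Y U B(1) D0
    by (intro approx_form_lower_bound) (auto simp: X_def D_def N_def)
  also have "\<dots> \<le> of_nat D * (of_nat (N + 1) ^ (m + 3) * 2 ^ (2 * (c + N) + m * (c + N + n))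
      * (\<Sum>j\<le>m. \<bar>of_int (l j)\<bar>) * of_int \<bar>a\<bar> ^ N) * of_int \<bar>a\<bar> ^ B"
    unfolding N_def using pos c e a by (intro mult_right_mono mult_left_mono approx_form_bound) auto
  finally have h: "of_int \<bar>a\<bar> ^ n * of_int \<bar>a\<bar> ^ N \<le> of_nat D * (of_nat (N + 1) ^ (m + 3) * 2 ^ (2 * (c + N) + m * (c + N + n))
      * (\<Sum>j\<le>m. \<bar>of_int (l j)\<bar>)) * (of_int \<bar>a\<bar> :: rat) ^ B * of_int \<bar>a\<bar> ^ N"
    by (simp only: power_add mult_ac)
  have "(0::rat) < of_int \<bar>a\<bar> ^ N" using a1 by simp
  from mult_right_le_imp_le[OF h this]
  have "of_int \<bar>a\<bar> ^ n \<le> of_nat D * (of_nat (N + 1) ^ (m + 3) * 2 ^ (2 * (c + N) + m * (c + N + n))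
      * (\<Sum>j\<le>m. \<bar>of_int (l j)\<bar>)) * (of_int \<bar>a\<bar> :: rat) ^ B" .
  \<comment> \<open>Both sides are integers, which is how the inequality passes from the rationals
    to the reals.\<close>
  hence "(of_int (\<bar>a\<bar> ^ n) :: rat) \<le> of_int (int D * (int (N + 1) ^ (m + 3) * 2 ^ (2 * (c + N) + m * (c + N + n))
      * (\<Sum>j\<le>m. \<bar>l j\<bar>)) * \<bar>a\<bar> ^ B)"
    by (simp only: of_int_mult of_int_power of_int_sum of_int_abs of_int_of_nat_eq of_int_numeral)
  hence "\<bar>a\<bar> ^ n \<le> int D * (int (N + 1) ^ (m + 3) * 2 ^ (2 * (c + N) + m * (c + N + n)) * (\<Sum>j\<le>m. \<bar>l j\<bar>)) * \<bar>a\<bar> ^ B"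
    by (simp only: of_int_le_iff)
  hence "real_of_int (\<bar>a\<bar> ^ n) \<le> real_of_int (int D * (int (N + 1) ^ (m + 3) * 2 ^ (2 * (c + N) + m * (c + N + n)) * (\<Sum>j\<le>m. \<bar>l j\<bar>)) * \<bar>a\<bar> ^ B)"
    by (simp only: of_int_le_iff)
  hence "real_of_int \<bar>a\<bar> ^ n \<le> real D * (real (N + 1) ^ (m + 3) * 2 ^ (2 * (c + N) + m * (c + N + n)) * (\<Sum>j\<le>m. \<bar>real_of_int (l j)\<bar>)) * real_of_int \<bar>a\<bar> ^ B"
    by (simp only: of_int_mult of_int_power of_int_sum of_int_abs of_int_of_nat_eq of_int_numeral)
  also have "\<dots> \<le> real D * (real (N + 1) ^ (m + 3) * 2 ^ (2 * (c + N) + m * (c + N + n)) * (\<Sum>j\<le>m. \<bar>real_of_int (l j)\<bar>)) * (8 * real X ^ 2) ^ g"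
  proof (rule mult_left_mono)
    have "real_of_int \<bar>a\<bar> \<le> 2 ^ g" using g by (metis of_int_le_iff of_int_numeral of_int_power)
    hence "real_of_int \<bar>a\<bar> ^ B \<le> (2 ^ g) ^ B" by (intro power_mono) auto
    also have "\<dots> = (real (2 ^ B)) ^ g" by (simp add: power_mult[symmetric] mult.commute)
    also have "real (2 ^ B) \<le> real (8 * X ^ 2)" using B(2) by (rule of_nat_mono)
    hence "(real (2 ^ B)) ^ g \<le> (8 * real X ^ 2) ^ g" by (intro power_mono) auto
    finally show "real_of_int \<bar>a\<bar> ^ B \<le> (8 * real X ^ 2) ^ g" .
  qed (auto intro!: mult_nonneg_nonneg sum_nonneg)
  finally show ?thesis unfolding D_def X_def by simp
qed

text \<open>All factors of the growth estimate that depend on \<open>n\<close> are sorted into a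
  power (n+1)^G and an exponential Q^n. As the estimate holds for every \<open>n\<close>, it forces
  |a| \<le> Q.\<close>

lemma global_relation_size_bound:
  fixes \<alpha> :: "nat \<Rightarrow> rat" and m :: nat and a :: int
  assumes m: "m \<ge> 1"
    and pos: "\<And>j. j \<le> m \<Longrightarrow> \<alpha> j > 0"
    and dist: "\<And>i j. 1 \<le> i \<Longrightarrow> i < j \<Longrightarrow> j \<le> m \<Longrightarrow> \<alpha> i - \<alpha> j \<notin> \<int>"
    and a: "\<bar>a\<bar> > 1" and cop: "coprime a (int (s_lcm \<alpha> m))"
    and glob: "global_relation \<alpha> m a"
  shows "real_of_int \<bar>a\<bar> \<le> 2 ^ (2 * m + m * (m + 1) + 2 * m * V_max \<alpha> m) * (\<Prod>j=1..m. real (sden \<alpha> j))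
     * (real (d_tilde \<alpha> m) * real (sden \<alpha> 0) * eps (sden \<alpha> 0) * eps (s_lcm \<alpha> m) ^ 2) ^ m"
proof -
  obtain l where l: "\<exists>j\<le>m. l j \<noteq> 0" and rel: "\<And>p. prime p \<Longrightarrow> int p dvd a \<Longrightarrow> padic_relation \<alpha> m l a p"
    using glob unfolding global_relation_def by blast
  define V where "V = V_max \<alpha> m"
  \<comment> \<open>The summands are the numerators u_j, so \<open>U\<close> exceeds each of them,
    and the leading 1 gives U \<ge> 1. In the same way \<open>c\<close> dominates every
    \<alpha>_j.\<close>
  define U where "U = 1 + (\<Sum>j=1..m. nat \<lfloor>(\<alpha> j + \<alpha> 0) * of_nat (vden \<alpha> j)\<rfloor>)"
  define c where "c = 1 + (\<Sum>j\<le>m. nat \<lceil>\<alpha> j\<rceil>)"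
  \<comment> \<open>Any exponent with |a| \<le> 2^g will do, because \<open>g\<close> enters only
    \<open>K\<close> and \<open>G\<close> and leaves the growth rate \<open>Q\<close>
    unchanged.\<close>
  define g where "g = nat \<bar>a\<bar>"
  have Y: "u + vden \<alpha> j * i \<le> U + V * i"
    if j: "1 \<le> j" "j \<le> m" and u: "\<alpha> j + \<alpha> 0 = of_nat u / of_nat (vden \<alpha> j)" for j u i
  proof -
    have "vden \<alpha> j > 0" using vden_fraction[of \<alpha> j] pos j by (metis le0)
    hence "(\<alpha> j + \<alpha> 0) * of_nat (vden \<alpha> j) = of_nat u" unfolding u by simp
    hence "u = nat \<lfloor>(\<alpha> j + \<alpha> 0) * of_nat (vden \<alpha> j)\<rfloor>" by simp
    also have "\<dots> \<le> (\<Sum>j=1..m. nat \<lfloor>(\<alpha> j + \<alpha> 0) * of_nat (vden \<alpha> j)\<rfloor>)"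
      using j by (intro member_le_sum[where f = "\<lambda>j. nat \<lfloor>(\<alpha> j + \<alpha> 0) * of_nat (vden \<alpha> j)\<rfloor>"]) auto
    finally have "u \<le> U" unfolding U_def by simp
    moreover have "vden \<alpha> j \<le> V" unfolding V_def V_max_def using j by (intro Max_ge) auto
    ultimately show ?thesis by (intro add_mono mult_right_mono) auto
  qed
  have c: "\<alpha> j \<le> of_nat c" if "j \<le> m" for j
  proof -
    have "nat \<lceil>\<alpha> j\<rceil> \<le> (\<Sum>j\<le>m. nat \<lceil>\<alpha> j\<rceil>)"
      using that by (intro member_le_sum[where f = "\<lambda>j. nat \<lceil>\<alpha> j\<rceil>"]) auto
    hence "nat \<lceil>\<alpha> j\<rceil> \<le> c" unfolding c_def by simp
    hence "(of_nat (nat \<lceil>\<alpha> j\<rceil>) :: rat) \<le> of_nat c" by (rule of_nat_mono)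
    thus ?thesis using of_nat_ceiling[of "\<alpha> j"] by linarith
  qed
  have g: "\<bar>a\<bar> \<le> 2 ^ g"
  proof -
    have "int g \<le> int (2 ^ g)" using less_exp[of g] by (simp only: zle_int)
    thus ?thesis unfolding g_def by simp
  qed
  define s0 where "s0 = real (sden \<alpha> 0)"
  define e0 where "e0 = eps (sden \<alpha> 0)"
  define es where "es = eps (s_lcm \<alpha> m)"
  define dt where "dt = real (d_tilde \<alpha> m)"
  define P where "P = (\<Prod>j=1..m. real (sden \<alpha> j))"
  define \<Lambda> where "\<Lambda> = (\<Sum>j\<le>m. \<bar>real_of_int (l j)\<bar>)"
  \<comment> \<open>In the exponent of 2, the part 2m + m(m+1) is the coefficient of
    \<open>n\<close> in the archimedean bound, and 2mV comes from bounding the lcm by 4^(U + V N).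
    The square of \<open>es\<close> stems from one factor in each of the two denominators.\<close>
  define Q where "Q = 2 ^ (2 * m + m * (m + 1) + 2 * m * V) * P * (dt * s0 * e0 * es ^ 2) ^ m"
  define G where "G = m + 3 + 2 * g"
  define K where "K = (s0 * e0) ^ m * (dt * es) ^ m * 4 ^ (U + V * m) * (real (m + 1) ^ (m + 3) * 2 ^ (2 * (c + m) + m * (c + m)) * \<Lambda>)
      * (8 * real (U + V * (m + 1)) ^ 2) ^ g"
  have ge: "e0 \<ge> 1" "es \<ge> 1" unfolding e0_def es_def by (rule eps_ge_1)+
  have s: "sden \<alpha> j > 0" if "j \<le> m" for j using sden_fraction[of \<alpha> j] pos[OF that] by metis
  have s0: "s0 > 0" unfolding s0_def using s by simp
  have dt: "dt > 0" unfolding dt_def using d_tilde_pos[of m \<alpha>] pos by simp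
  have P: "P > 0" unfolding P_def using s by (intro prod_pos) simp
  have \<Lambda>: "\<Lambda> \<ge> 0" unfolding \<Lambda>_def by (intro sum_nonneg) simp
  have "real_of_int \<bar>a\<bar> \<le> Q"
  proof (rule exponential_vs_polynomial)
    show "Q > 0" unfolding Q_def using P s0 dt ge by (simp add: zero_less_mult_iff)
  next
    fix n
    define N where "N = m * n + m"
    define M where "M = 2 * (c + N) + m * (c + N + n)"
    have "real_of_int \<bar>a\<bar> ^ n \<le> real (approx_denom \<alpha> m n) * real (phi_denom \<alpha> m N (U + V * N))
      * (real (N + 1) ^ (m + 3) * 2 ^ M * \<Lambda>) * (8 * real (U + V * (N + n)) ^ 2) ^ g"
      unfolding N_def M_def \<Lambda>_def using m pos dist a cop l rel c Y g
      by (intro global_relation_growth) (auto simp: c_def U_def)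
    also have "\<dots> \<le> ((s0 * e0) ^ N * (P ^ n * (es ^ n) ^ m)) * ((dt * es) ^ N * 4 ^ (U + V * N))
      * ((real (m + 1) * (real n + 1)) ^ (m + 3) * 2 ^ M * \<Lambda>) * (8 * (real (U + V * (m + 1)) * (real n + 1)) ^ 2) ^ g"
    proof (intro mult_mono power_mono)
      show "real (approx_denom \<alpha> m n) \<le> (s0 * e0) ^ N * (P ^ n * (es ^ n) ^ m)"
        unfolding s0_def e0_def P_def es_def by (rule approx_denom_le[OF N_def])
      show "real (phi_denom \<alpha> m N (U + V * N)) \<le> (dt * es) ^ N * 4 ^ (U + V * N)"
        unfolding dt_def es_def by (rule phi_denom_le)
      have "N + 1 \<le> (m + 1) * (n + 1)" unfolding N_def by simp
      hence "real (N + 1) \<le> real ((m + 1) * (n + 1))" by (rule of_nat_mono)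
      thus "real (N + 1) \<le> real (m + 1) * (real n + 1)" by (simp add: algebra_simps)
      have "U + V * (N + n) \<le> U * (n + 1) + V * ((m + 1) * (n + 1))"
        unfolding N_def by (intro add_mono mult_left_mono) auto
      also have "\<dots> = (U + V * (m + 1)) * (n + 1)" by (simp add: algebra_simps)
      finally have "real (U + V * (N + n)) \<le> real ((U + V * (m + 1)) * (n + 1))" by (rule of_nat_mono)
      thus "real (U + V * (N + n)) \<le> real (U + V * (m + 1)) * (real n + 1)" by (simp add: algebra_simps)
    qed (use s0 dt P ge \<Lambda> in \<open>auto intro!: mult_nonneg_nonneg\<close>)
    also have "\<dots> = K * (real n + 1) ^ G * Q ^ n"
    proof -
      have pN: "x ^ N = x ^ m * (x ^ m) ^ n" for x :: real
        unfolding N_def by (simp add: power_add power_mult mult.commute)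
      have 4: "(4::real) ^ (U + V * N) = 4 ^ (U + V * m) * (2 ^ (2 * m * V)) ^ n"
      proof -
        have "U + V * N = (U + V * m) + m * V * n" unfolding N_def by (simp add: algebra_simps)
        hence "(4::real) ^ (U + V * N) = 4 ^ (U + V * m) * (4 ^ (m * V)) ^ n" by (simp add: power_add power_mult)
        also have "(4::real) ^ (m * V) = 2 ^ (2 * m * V)" by (simp add: power_mult mult.assoc)
        finally show ?thesis .
      qed
      have M: "(2::real) ^ M = 2 ^ (2 * (c + m) + m * (c + m)) * (2 ^ (2 * m + m * (m + 1))) ^ n"
      proof -
        have "M = (2 * (c + m) + m * (c + m)) + (2 * m + m * (m + 1)) * n" unfolding M_def N_def by (simp add: algebra_simps)
        thus ?thesis by (simp only: power_add power_mult)
      qed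
      have Qn: "Q ^ n = (2 ^ (2 * m + m * (m + 1))) ^ n * (2 ^ (2 * m * V)) ^ n * P ^ n * ((s0 * e0) ^ m) ^ n * ((dt * es) ^ m) ^ n * (es ^ n) ^ m"
        unfolding Q_def by (simp add: power_mult_distrib power_add power2_eq_square mult_ac power_mult[symmetric])
      have sq: "((real n + 1)\<^sup>2) ^ g = ((real n + 1) ^ g)\<^sup>2" by (simp add: power_mult[symmetric] mult.commute)
      show ?thesis
        unfolding pN[of "s0 * e0"] pN[of "dt * es"] 4 M Qn K_def G_def power_mult_distrib[of _ "real n + 1"]
        by (simp add: power_mult_distrib power_add power_mult mult_ac sq)
    qed
    finally show "real_of_int \<bar>a\<bar> ^ n \<le> K * (real n + 1) ^ G * Q ^ n" .
  qed
  thus ?thesis unfolding Q_def V_def P_def dt_def s0_def e0_def es_def .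
qed

text \<open>The logarithm of the size bound is compared with \<open>logC\<close>: the product of the
  s_j is at most exp (m S), the power of 2 is at most exp M, and q^m \<le> Q^(m+1) because Q = q d
  \<epsilon>(v) with q \<ge> 1 and d \<epsilon>(v) \<ge> 1.\<close>

theorem theorem3:
  fixes \<alpha> :: "nat \<Rightarrow> rat" and m :: nat and a :: int
  assumes "m \<ge> 1"
    and "\<And>j. j \<le> m \<Longrightarrow> \<alpha> j > 0"
    and "\<And>i j. 1 \<le> i \<Longrightarrow> i < j \<Longrightarrow> j \<le> m \<Longrightarrow> \<alpha> i - \<alpha> j \<notin> \<int>"
    and "\<bar>a\<bar> > 1"
    and "coprime a (int (s_lcm \<alpha> m))"
    and "ln (real_of_int \<bar>a\<bar>) > logC \<alpha> m"
  shows "\<not> global_relation \<alpha> m a"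
proof
  assume glob: "global_relation \<alpha> m a"
  define q where "q = real (d_tilde \<alpha> m) * real (sden \<alpha> 0) * eps (sden \<alpha> 0) * eps (s_lcm \<alpha> m) ^ 2"
  define Q where "Q = real (d_lcm \<alpha> m) * real (d_tilde \<alpha> m) * real (sden \<alpha> 0)
                              * eps (sden \<alpha> 0) * eps (s_lcm \<alpha> m) ^ 2 * eps (v_lcm \<alpha> m)"
  define V where "V = V_max \<alpha> m"
  define M where "M = 2 * m + m * (m + 1) + 2 * m * V"
  have s: "sden \<alpha> j > 0" if "j \<le> m" for j using sden_fraction[of \<alpha> j] assms(2)[OF that] by metis
  have d: "real (d_lcm \<alpha> m) \<ge> 1" "real (d_tilde \<alpha> m) \<ge> 1" "real (sden \<alpha> 0) \<ge> 1"
    using d_lcm_pos[of m \<alpha>] d_tilde_pos[of m \<alpha>] assms(2) s[of 0] by (auto simp: Suc_le_eq)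
  have q: "q \<ge> 1" unfolding q_def
    using d eps_ge_1[of "sden \<alpha> 0"] eps_ge_1[of "s_lcm \<alpha> m"] by (simp add: one_le_mult_iff mult_ge1_I one_le_power)
  have qQ: "q \<le> Q"
  proof -
    have "Q = q * (real (d_lcm \<alpha> m) * eps (v_lcm \<alpha> m))" unfolding Q_def q_def by simp
    moreover have "1 \<le> real (d_lcm \<alpha> m) * eps (v_lcm \<alpha> m)"
      using d eps_ge_1[of "v_lcm \<alpha> m"] by (simp add: mult_ge1_I)
    ultimately show ?thesis using q by simp
  qed
  have V: "V \<ge> 1"
  proof -
    have "vden \<alpha> 1 > 0" using vden_fraction[of \<alpha> 1] assms(1,2) by (metis le0)
    moreover have "vden \<alpha> 1 \<le> V" unfolding V_def V_max_def using assms(1) by (intro Max_ge) auto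
    ultimately show ?thesis by simp
  qed
  have "real_of_int \<bar>a\<bar> \<le> 2 ^ M * (\<Prod>j=1..m. real (sden \<alpha> j)) * q ^ m"
    using global_relation_size_bound[of m \<alpha> a] assms glob unfolding M_def V_def q_def by blast
  also have "\<dots> \<le> exp (real M) * exp (real m * real (S_max \<alpha> m)) * exp ((real m + 1) * ln Q)"
  proof (intro mult_mono)
    have "(2::real) ^ M \<le> exp 1 ^ M" using exp_ge_add_one_self[of 1] by (intro power_mono) auto
    thus "2 ^ M \<le> exp (real M)" by (simp add: exp_of_nat_mult[symmetric])
    have "real (sden \<alpha> j) \<le> exp (real (S_max \<alpha> m))" if "j \<in> {1..m}" for j
    proof -
      have "sden \<alpha> j \<le> S_max \<alpha> m" unfolding S_max_def using that by (intro Max_ge) auto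
      hence "real (sden \<alpha> j) \<le> real (S_max \<alpha> m)" by (rule of_nat_mono)
      thus ?thesis using exp_ge_add_one_self[of "real (S_max \<alpha> m)"] by linarith
    qed
    hence "(\<Prod>j=1..m. real (sden \<alpha> j)) \<le> (\<Prod>j=1..m. exp (real (S_max \<alpha> m)))" by (intro prod_mono) auto
    thus "(\<Prod>j=1..m. real (sden \<alpha> j)) \<le> exp (real m * real (S_max \<alpha> m))"
      by (simp add: exp_of_nat_mult[symmetric])
    have "q ^ m \<le> q ^ (m + 1)" using q by (intro power_increasing) auto
    also have "\<dots> \<le> Q ^ (m + 1)" using q qQ by (intro power_mono) auto
    also have "\<dots> = exp (real (m + 1) * ln Q)" using q qQ by (simp only: exp_of_nat_mult) simp
    finally show "q ^ m \<le> exp ((real m + 1) * ln Q)" by (simp add: add.commute)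
  qed (use q in \<open>auto intro!: mult_nonneg_nonneg prod_nonneg\<close>)
  also have "\<dots> = exp (real M + real m * real (S_max \<alpha> m) + (real m + 1) * ln Q)" by (simp add: exp_add)
  finally have "ln (real_of_int \<bar>a\<bar>) \<le> ln (exp (real M + real m * real (S_max \<alpha> m) + (real m + 1) * ln Q))"
    using assms(4) by (intro ln_mono) auto
  also have "\<dots> = real M + real m * real (S_max \<alpha> m) + (real m + 1) * ln Q" by simp
  also have "\<dots> \<le> logC \<alpha> m"
  proof -
    \<comment> \<open>This rests on V \<ge> 1: with V = w + 1 the difference of the two sides has
      nonnegative coefficients as a polynomial in \<open>m\<close>, \<open>w\<close> and
      s_0.\<close>
    have "M \<le> (m + 1) * (3 + 2 * sden \<alpha> 0 + (m + 1) * V)"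
    proof -
      obtain w where "V = Suc w" using V by (cases V) auto
      thus ?thesis unfolding M_def by (simp add: algebra_simps)
    qed
    hence "real M \<le> real ((m + 1) * (3 + 2 * sden \<alpha> 0 + (m + 1) * V))" by (rule of_nat_mono)
    thus ?thesis unfolding logC_def Q_def V_def by (simp add: algebra_simps)
  qed
  finally show False using assms(6) by simp
qed

end
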